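(* For every virtual string $\alpha$, $t(\mu([\alpha]))\geq t(\nu([\alpha]))$, and there exist virtual homotopy classes $[\alpha]$ for which this inequality is strict. (That is, the lower bound on $m([\alpha])$ given by $\mu$ is stronger than the one given by Turaev's cobracket $\nu$.)
   Context: Virtual strings. A virtual string $\alpha$ is an oriented circle $S^1$ (the core circle) with a finite set $\mathrm{arr}(\alpha)$ of arrows; an arrow is an ordered pair $(a,b)$ of points of $S^1$ with tail $a$ and head $b$, and all endpoints of arrows are pairwise distinct. Strings are considered up to orientation-preserving homeomorphism of the core circle. For distinct $x,y\in S^1$, $xy$ denotes the arc from $x$ to $y$ in the positive direction and $(xy)^\circ$ its interior. Two virtual strings are (virtually) homotopic if they are related by a finite sequence of the following moves and their inverses. Type 1: if the arc $ab$ contains no endpoints of arrows, add the arrow $(a,b)$ or the arrow $(b,a)$. Type 2: given two disjoint arcs containing no endpoints of arrows, the first with endpoints $a,a'$ (in either order) and the second with endpoints $b,b'$ (in either order), add the two arrows $(a,b)$ and $(b',a')$. Type 3a: given disjoint arcs $aa^+,bb^+,cc^+$ with no arrow endpoints in their interiors, such that $(a^+,b),(b^+,c),(c^+,a)$ are arrows, replace these by $(a,b^+),(b,c^+),(c,a^+)$. Type 3b: given such arcs where $(a,b),(a^+,c),(b^+,c^+)$ are arrows, replace these by $(a^+,b^+),(a,c^+),(b,c)$. The homotopy class of $\alpha$ is $[\alpha]$; it is trivial if it contains the string with no arrows. $m([\alpha])$ is the minimum of $|\mathrm{arr}(\beta)|$ over $\beta\in[\alpha]$. Signed singular virtual strings.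 A signed singular virtual string $\alpha_d^\epsilon$ is a virtual string $\alpha$ with a distinguished arrow $d\in\mathrm{arr}(\alpha)$ and a sign $\epsilon\in\{+,-\}$. Two of them are homotopic if related by a finite sequence of the following moves and inverses: Type 1, 2, 3 moves not involving the distinguished arrow; signed singular Type 2: if $e=(a,b)$ and $e'=(b',a')$ are arrows, where $a,a'$ and $b,b'$ are the endpoints of two disjoint arcs with no arrow endpoints in their interiors, and one of $e,e'$ is distinguished, make the other one distinguished instead and reverse the sign (no arrow is removed); signed singular Type 3: a Type 3a or 3b move in which one of the three arrows is distinguished, the arrow replacing it becomes distinguished, and the sign is kept. The class is written $[\alpha_d^\epsilon]$. A signed singular string is semi-trivial if its distinguished arrow $(a,b)$ is such that $(ab)^\circ$ or $(ba)^\circ$ contains no endpoint of an arrow; a homotopy class is semi-trivial if it contains a semi-trivial signed singular string. The operation $\mu$. Let $\mathcal{S}_0^\Theta$ be the set of homotopy classes of signed singular virtual strings that are not semi-trivial. Put $\mu([\alpha])=\sum_{e\in \mathrm{arr}(\alpha)}\big([\alpha_e^+]-[\alpha_e^-]\big)\in\mathbb{Z}[\mathcal{S}_0^\Theta]$, where semi-trivial classes are set equal to $0$; this depends only on $[\alpha]$. Turaev's cobracket $\nu$. For an arrow $e=(a,b)$ of $\alpha$, let $\alpha_e^1$ (respectively $\alpha_e^2$) be the virtual string obtained from $\alpha$ by deleting all arrows except those with both tail and head in $(ab)^\circ$ (respectively $(ba)^\circ$). Let $\mathcal{S}_0$ be the set of nontrivial homotopy classes of virtual strings. Put $\nu([\alpha])=\sum_{e\in\mathrm{arr}(\alpha)}\big([\alpha_e^1]\otimes[\alpha_e^2]-[\alpha_e^2]\otimes[\alpha_e^1]\big)\in\mathbb{Z}[\mathcal{S}_0]\otimes\mathbb{Z}[\mathcal{S}_0]$,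 where trivial classes are set equal to $0$; this depends only on $[\alpha]$. Number of terms. For a reduced linear combination $L=\sum_i a_ie_i$ in a free $\mathbb{Z}$-module with distinct basis elements $e_i$, $t(L)=\sum_i|a_i|$; for $\nu$ the basis of $\mathbb{Z}[\mathcal{S}_0]\otimes\mathbb{Z}[\mathcal{S}_0]$ consists of the $x\otimes y$ with $x,y\in\mathcal{S}_0$. *)

theory Defs
  imports "HOL-Analysis.Analysis" "HOL-Library.Poly_Mapping"
begin

section \<open>The core circle\<close>

abbreviation core :: "complex set" where
  "core \<equiv> sphere 0 1"

text \<open>
  The closed arc from \<open>x\<close> to \<open>y\<close> in the positive (counterclockwise) direction: the points whose
  angle, measured from \<open>x\<close>, is at most that of \<open>y\<close>.
\<close>

definition pos_arc :: "complex \<Rightarrow> complex \<Rightarrow> complex set" where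
  "pos_arc x y = {z \<in> core. Arg2pi (z / x) \<le> Arg2pi (y / x)}"

definition open_arc :: "complex \<Rightarrow> complex \<Rightarrow> complex set" where
  "open_arc x y = pos_arc x y - {x, y}"

definition arc_with_ends :: "complex set \<Rightarrow> complex \<Rightarrow> complex \<Rightarrow> bool" where
  "arc_with_ends I x y \<longleftrightarrow> x \<in> core \<and> y \<in> core \<and> x \<noteq> y \<and> (I = pos_arc x y \<or> I = pos_arc y x)"

text \<open>
  A self-homeomorphism of the circle preserves the orientation when it carries positive arcs to
  positive arcs; a reflection would carry \<open>pos_arc x y\<close> to \<open>pos_arc (h y) (h x)\<close>.
\<close>

definition orientation_preserving_homeo :: "(complex \<Rightarrow> complex) \<Rightarrow> bool" where
  "orientation_preserving_homeo h \<longleftrightarrow>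
     (\<exists>g. homeomorphism core core h g) \<and>
     (\<forall>x\<in>core. \<forall>y\<in>core. x \<noteq> y \<longrightarrow> h ` pos_arc x y = pos_arc (h x) (h y))"


section \<open>Virtual strings and virtual homotopy\<close>

text \<open>An arrow is the pair (tail, head).\<close>

type_synonym arrow = "complex \<times> complex"

definition is_virtual_string :: "arrow set \<Rightarrow> bool" where
  "is_virtual_string A \<longleftrightarrow>
     finite A \<and> A \<subseteq> core \<times> core \<and> (\<forall>e\<in>A. fst e \<noteq> snd e) \<and>
     (\<forall>e\<in>A. \<forall>f\<in>A. e \<noteq> f \<longrightarrow> {fst e, snd e} \<inter> {fst f, snd f} = {})"

typedef vstring = "{A. is_virtual_string A}" morphisms arr Vstring
  by (rule exI[of _ "{}"]) (simp add: is_virtual_string_def)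

setup_lifting type_definition_vstring

lift_definition empty_string :: vstring is "{}"
  by (simp add: is_virtual_string_def)

lift_definition restrict_string :: "vstring \<Rightarrow> complex set \<Rightarrow> vstring"
  is "\<lambda>A X. {e \<in> A. fst e \<in> X \<and> snd e \<in> X}"
  unfolding is_virtual_string_def by (auto simp: subset_iff)

definition endpoints :: "vstring \<Rightarrow> complex set" where
  "endpoints \<alpha> = fst ` arr \<alpha> \<union> snd ` arr \<alpha>"

inductive homeo_move :: "(complex \<Rightarrow> complex) \<Rightarrow> vstring \<Rightarrow> vstring \<Rightarrow> bool" where
  "homeo_move h \<alpha> \<beta>"
    if "orientation_preserving_homeo h" "arr \<beta> = map_prod h h ` arr \<alpha>"

inductive type1_move :: "vstring \<Rightarrow> vstring \<Rightarrow> bool" where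
  "type1_move \<alpha> \<beta>"
    if "a \<in> core" "b \<in> core" "a \<noteq> b" "pos_arc a b \<inter> endpoints \<alpha> = {}"
       "arr \<beta> = insert (a, b) (arr \<alpha>) \<or> arr \<beta> = insert (b, a) (arr \<alpha>)"

inductive type2_move :: "vstring \<Rightarrow> vstring \<Rightarrow> bool" where
  "type2_move \<alpha> \<beta>"
    if "arc_with_ends I a a'" "arc_with_ends J b b'" "I \<inter> J = {}"
       "I \<inter> endpoints \<alpha> = {}" "J \<inter> endpoints \<alpha> = {}"
       "arr \<beta> = arr \<alpha> \<union> {(a, b), (b', a')}"

text \<open>
  The second argument of \<open>type3_move\<close> is the set of the three pairs (arrow, arrow replacing it).
  The first alternative for it is a move of type 3a, the second one a move of type 3b.
\<close>

inductive type3_move :: "vstring \<Rightarrow> (arrow \<times> arrow) set \<Rightarrow> vstring \<Rightarrow> bool" where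
  "type3_move \<alpha> R \<beta>"
    if "{a, a', b, b', c, c'} \<subseteq> core" "a \<noteq> a'" "b \<noteq> b'" "c \<noteq> c'"
       "pos_arc a a' \<inter> pos_arc b b' = {}" "pos_arc b b' \<inter> pos_arc c c' = {}"
       "pos_arc c c' \<inter> pos_arc a a' = {}"
       "(open_arc a a' \<union> open_arc b b' \<union> open_arc c c') \<inter> endpoints \<alpha> = {}"
       "R = {((a', b), (a, b')), ((b', c), (b, c')), ((c', a), (c, a'))} \<or>
        R = {((a, b), (a', b')), ((a', c), (a, c')), ((b', c'), (b, c))}"
       "fst ` R \<subseteq> arr \<alpha>"
       "arr \<beta> = (arr \<alpha> - fst ` R) \<union> snd ` R"

definition move :: "vstring \<Rightarrow> vstring \<Rightarrow> bool" where
  "move \<alpha> \<beta> \<longleftrightarrow>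
     (\<exists>h. homeo_move h \<alpha> \<beta>) \<or> type1_move \<alpha> \<beta> \<or> type2_move \<alpha> \<beta> \<or> (\<exists>R. type3_move \<alpha> R \<beta>)"

definition homotopic_strings :: "vstring \<Rightarrow> vstring \<Rightarrow> bool" where
  "homotopic_strings = equivclp move"

quotient_type vclass = vstring / homotopic_strings
  morphisms rep_vclass vclass_of
  by (simp add: homotopic_strings_def)

definition trivial_class :: "vclass \<Rightarrow> bool" where
  "trivial_class X \<longleftrightarrow> X = vclass_of empty_string"


section \<open>Signed singular virtual strings\<close>

datatype sgn = Pos | Neg

fun opposite :: "sgn \<Rightarrow> sgn" where
  "opposite Pos = Neg"
| "opposite Neg = Pos"

type_synonym sstring = "vstring \<times> arrow \<times> sgn"

definition is_signed_singular :: "sstring \<Rightarrow> bool" where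
  "is_signed_singular = (\<lambda>(\<alpha>, d, \<epsilon>). d \<in> arr \<alpha>)"

text \<open>
  In \<open>regular1\<close> and \<open>regular2\<close> the arrows that are added differ from the distinguished arrow,
  because the latter already belongs to \<open>\<alpha>\<close>.
\<close>

inductive smove :: "sstring \<Rightarrow> sstring \<Rightarrow> bool" where
  homeo: "smove (\<alpha>, d, \<epsilon>) (\<beta>, map_prod h h d, \<epsilon>)"
    if "d \<in> arr \<alpha>" "homeo_move h \<alpha> \<beta>"
| regular1: "smove (\<alpha>, d, \<epsilon>) (\<beta>, d, \<epsilon>)"
    if "d \<in> arr \<alpha>" "type1_move \<alpha> \<beta>"
| regular2: "smove (\<alpha>, d, \<epsilon>) (\<beta>, d, \<epsilon>)"
    if "d \<in> arr \<alpha>" "type2_move \<alpha> \<beta>"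
| regular3: "smove (\<alpha>, d, \<epsilon>) (\<beta>, d, \<epsilon>)"
    if "d \<in> arr \<alpha>" "type3_move \<alpha> R \<beta>" "d \<notin> fst ` R"
| singular2: "smove (\<alpha>, d, \<epsilon>) (\<alpha>, d', opposite \<epsilon>)"
    if "arc_with_ends I a a'" "arc_with_ends J b b'" "I \<inter> J = {}"
       "(I - {a, a'}) \<inter> endpoints \<alpha> = {}" "(J - {b, b'}) \<inter> endpoints \<alpha> = {}"
       "(a, b) \<in> arr \<alpha>" "(b', a') \<in> arr \<alpha>"
       "(d, d') = ((a, b), (b', a')) \<or> (d, d') = ((b', a'), (a, b))"
| singular3: "smove (\<alpha>, d, \<epsilon>) (\<beta>, d', \<epsilon>)"
    if "type3_move \<alpha> R \<beta>" "(d, d') \<in> R"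

definition homotopic_singular :: "sstring \<Rightarrow> sstring \<Rightarrow> bool" where
  "homotopic_singular x y \<longleftrightarrow>
     is_signed_singular x \<and> is_signed_singular y \<and> equivclp smove x y"

lemma part_equivp_homotopic_singular: "part_equivp homotopic_singular"
proof (rule part_equivpI)
  have "is_virtual_string {(1, -1)}"
    by (simp add: is_virtual_string_def)
  then have "is_signed_singular (Vstring {(1, -1)}, (1, -1), Pos)"
    by (simp add: is_signed_singular_def Vstring_inverse)
  then show "\<exists>x. homotopic_singular x x"
    by (auto simp: homotopic_singular_def simp del: split_paired_Ex)
  show "symp homotopic_singular"
    by (auto simp: symp_def homotopic_singular_def intro: equivclp_sym)
  show "transp homotopic_singular"
    unfolding transp_def homotopic_singular_def by (meson equivclp_trans)
qed

quotient_type sclass = sstring / partial: homotopic_singular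
  morphisms rep_sclass sclass_of
  by (rule part_equivp_homotopic_singular)

definition semi_trivial_string :: "sstring \<Rightarrow> bool" where
  "semi_trivial_string = (\<lambda>(\<alpha>, (a, b), \<epsilon>).
     (a, b) \<in> arr \<alpha> \<and>
     (open_arc a b \<inter> endpoints \<alpha> = {} \<or> open_arc b a \<inter> endpoints \<alpha> = {}))"

definition semi_trivial_class :: "sclass \<Rightarrow> bool" where
  "semi_trivial_class X \<longleftrightarrow> (\<exists>s. semi_trivial_string s \<and> sclass_of s = X)"


section \<open>The operations \<open>\<mu>\<close> and \<open>\<nu>\<close>\<close>

text \<open>
  The type \<open>'b \<Rightarrow>\<^sub>0 int\<close> is the free abelian group on \<open>'b\<close>. The sub-bases of classes that are not
  semi-trivial (resp. nontrivial) are obtained by sending the other generators to 0, and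
  the tensor square of the free group on nontrivial classes is the free group on pairs of them.
\<close>

definition sgen :: "sclass \<Rightarrow> sclass \<Rightarrow>\<^sub>0 int" where
  "sgen X = (if semi_trivial_class X then 0 else Poly_Mapping.single X 1)"

definition tensor :: "vclass \<Rightarrow> vclass \<Rightarrow> (vclass \<times> vclass) \<Rightarrow>\<^sub>0 int" where
  "tensor X Y =
     (if trivial_class X \<or> trivial_class Y then 0 else Poly_Mapping.single (X, Y) 1)"

definition mu_string :: "vstring \<Rightarrow> sclass \<Rightarrow>\<^sub>0 int" where
  "mu_string \<alpha> = (\<Sum>e\<in>arr \<alpha>. sgen (sclass_of (\<alpha>, e, Pos)) - sgen (sclass_of (\<alpha>, e, Neg)))"

definition side1 :: "vstring \<Rightarrow> arrow \<Rightarrow> vstring" where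
  "side1 \<alpha> e = restrict_string \<alpha> (open_arc (fst e) (snd e))"

definition side2 :: "vstring \<Rightarrow> arrow \<Rightarrow> vstring" where
  "side2 \<alpha> e = restrict_string \<alpha> (open_arc (snd e) (fst e))"

definition nu_string :: "vstring \<Rightarrow> (vclass \<times> vclass) \<Rightarrow>\<^sub>0 int" where
  "nu_string \<alpha> = (\<Sum>e\<in>arr \<alpha>.
     tensor (vclass_of (side1 \<alpha> e)) (vclass_of (side2 \<alpha> e)) -
     tensor (vclass_of (side2 \<alpha> e)) (vclass_of (side1 \<alpha> e)))"

text \<open>
  The two sums are the same for all representatives of a homotopy class; on a class, \<open>\<mu>\<close> and \<open>\<nu>\<close>
  are this common value, that is, the element of a one-element set.
\<close>

definition mu :: "vclass \<Rightarrow> sclass \<Rightarrow>\<^sub>0 int" where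
  "mu X = the_elem (mu_string ` {\<alpha>. vclass_of \<alpha> = X})"

definition nu :: "vclass \<Rightarrow> (vclass \<times> vclass) \<Rightarrow>\<^sub>0 int" where
  "nu X = the_elem (nu_string ` {\<alpha>. vclass_of \<alpha> = X})"

definition num_terms :: "('b \<Rightarrow>\<^sub>0 int) \<Rightarrow> int" where
  "num_terms L = (\<Sum>x\<in>Poly_Mapping.keys L. \<bar>Poly_Mapping.lookup L x\<bar>)"

end

theory Submission
  imports Defs
begin

text \<open>
  Let an arrow \<open>d\<close> of a string cut the core circle into two open arcs, and keep on each of them
  the arrows with both ends there. The resulting pair of homotopy classes, taken in the opposite
  order when the sign is negative, is an invariant of signed singular homotopy (\<open>smove_sides\<close>).
  So sending a signed singular class to the tensor product of its two sides defines a linear map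
  on the target of \<open>\<mu>\<close>. A semi-trivial class has an empty side, so it is sent to 0, and therefore
  the map carries \<open>\<mu>\<close> to \<open>\<nu>\<close> (\<open>nu_string_eq\<close>). It takes each basis element to a basis element
  or to 0, and such a map cannot increase the number of terms. This gives the inequality, and with
  it the fact that \<open>\<nu>\<close> is well defined once \<open>\<mu>\<close> is.

  The geometric work is the invariance of the two sides. A move that does not involve \<open>d\<close> takes
  place along arcs each of which lies on one side of \<open>d\<close>; on a given side it is again a move of
  the same type, or nothing happens, or, for a move of type 3, a single arrow survives and its two
  ends slide along arcs free of other ends. Such a slide is a homotopy: create a pair of opposite
  arrows next to the new position by a move of type 2, then cancel one of them against the old
  arrow (\<open>slide_arrow\<close>). When \<open>d\<close> itself moves, its ends run through two short arcs, and the
  circle outside the common part of the old and the new side is a single arc, which contains no end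
  of the arrows that stay on that side. Ends of the remaining arrows can be pushed across this arc, and
  the change on a side becomes a move of type 1, a move of type 2 or a slide (\<open>parallel_arrows_sides\<close>,
  \<open>marked_triangle.homotopic_sides\<close>).

  For strictness one needs an invariant that sees the arrows crossing \<open>d\<close>, which the two sides
  forget. It is the number of arrows crossing \<open>d\<close>, counted with signs and multiplied by the sign
  of the singular string (\<open>smove_signed_index\<close>); it vanishes on semi-trivial classes. Take one
  arrow \<open>e\<close> crossed in the same direction by two arrows that do not cross each other. Every arrow
  has an empty side, so \<open>\<nu>\<close> is 0. The six singular strings have signed indices \<open>2, -2\<close> for \<open>e\<close>
  and \<open>-1, 1\<close> for each of the other two arrows, so the positive class of \<open>e\<close> occurs in \<open>\<mu>\<close>
  with coefficient 1 (\<open>exists_strict_inequality\<close>).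
\<close>

section \<open>Arcs of the circle in angular coordinates\<close>

lemma core_eq_iff_Arg2pi:
  assumes "x \<in> core" "y \<in> core"
  shows "x = y \<longleftrightarrow> Arg2pi x = Arg2pi y"
  using assms Arg2pi_eq[of x] Arg2pi_eq[of y] by auto

text \<open>
  Cutting the circle at the point 1 turns the position on the circle into a real number, and
  membership in an arc into inequalities between real numbers: the arc from \<open>x\<close> to \<open>y\<close> is an
  interval or, when it passes through 1, the complement of one.
\<close>

lemma mem_pos_arc:
  assumes "x \<in> core" "y \<in> core"
  shows "z \<in> pos_arc x y \<longleftrightarrow> z \<in> core \<and>
    (if Arg2pi x \<le> Arg2pi y then Arg2pi x \<le> Arg2pi z \<and> Arg2pi z \<le> Arg2pi y
     else Arg2pi x \<le> Arg2pi z \<or> Arg2pi z \<le> Arg2pi y)"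
proof -
  have nz: "w \<noteq> 0" if "w \<in> core" for w using that by auto
  have *: "Arg2pi (w / x) = (if Arg2pi x \<le> Arg2pi w then Arg2pi w - Arg2pi x else Arg2pi w - Arg2pi x + 2 * pi)"
    if w: "w \<in> core" for w
  proof (cases "Arg2pi x \<le> Arg2pi w")
    case True
    then show ?thesis using nz[OF w] nz[OF assms(1)] by (simp add: Arg2pi_divide)
  next
    case False
    \<comment> \<open>The angle of \<open>w / x\<close> is the full angle minus that of its inverse, since \<open>w\<close> lies before \<open>x\<close>.\<close>
    have xw: "Arg2pi (x / w) = Arg2pi x - Arg2pi w"
      using False nz[OF w] nz[OF assms(1)] by (simp add: Arg2pi_divide)
    show ?thesis
    proof (cases "x / w \<in> \<real>")
      case True
      then have "Arg2pi (x / w) = pi" using Arg2pi_eq_0_pi[of "x / w"] xw False by auto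
      moreover have "Arg2pi (inverse (x / w)) = Arg2pi (x / w)" unfolding Arg2pi_inverse using True by simp
      ultimately show ?thesis using xw False by (simp add: field_simps)
    next
      case nr: False
      then have "Arg2pi (inverse (x / w)) = 2 * pi - Arg2pi (x / w)" using Arg2pi_inverse[of "x / w"] by auto
      then show ?thesis using xw False by (simp add: field_simps)
    qed
  qed
  show ?thesis
  proof (cases "z \<in> core")
    case True
    show ?thesis unfolding pos_arc_def using True *[OF True] *[OF assms(2)]
      Arg2pi[of x] Arg2pi[of y] Arg2pi[of z] by auto
  qed (simp add: pos_arc_def)
qed

lemma mem_open_arc:
  assumes "x \<in> core" "y \<in> core"
  shows "z \<in> open_arc x y \<longleftrightarrow> z \<in> core \<and>
    (if Arg2pi x \<le> Arg2pi y then Arg2pi x < Arg2pi z \<and> Arg2pi z < Arg2pi y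
     else Arg2pi x < Arg2pi z \<or> Arg2pi z < Arg2pi y)"
  unfolding open_arc_def
  using mem_pos_arc[OF assms, of z] core_eq_iff_Arg2pi[of z x] core_eq_iff_Arg2pi[of z y] assms
  by (auto split: if_splits)

lemma pos_arc_subset_core: "pos_arc x y \<subseteq> core"
  by (auto simp: pos_arc_def)

lemma open_arc_subset_core: "open_arc x y \<subseteq> core"
  by (auto simp: pos_arc_def open_arc_def)

lemma exists_core_Arg2pi:
  assumes "0 \<le> t" "t < 2 * pi"
  shows "\<exists>z\<in>core. Arg2pi z = t"
proof
  show "Arg2pi (cis t) = t" using assms by (intro Arg2pi_unique[of 1]) (auto simp: cis_conv_exp)
  show "cis t \<in> core" by simp
qed

text \<open>
  The two predicates isolate the order-theoretic content of \<open>mem_pos_arc\<close>, so that statements about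
  several arcs become purely linear statements about angles.
\<close>

definition between :: "real \<Rightarrow> real \<Rightarrow> real \<Rightarrow> bool" where
  "between a b t \<longleftrightarrow> (if a \<le> b then a \<le> t \<and> t \<le> b else a \<le> t \<or> t \<le> b)"

definition strictly_between :: "real \<Rightarrow> real \<Rightarrow> real \<Rightarrow> bool" where
  "strictly_between a b t \<longleftrightarrow> (if a \<le> b then a < t \<and> t < b else a < t \<or> t < b)"

lemma pos_arc_between:
  "x \<in> core \<Longrightarrow> y \<in> core \<Longrightarrow> z \<in> core \<Longrightarrow> z \<in> pos_arc x y \<longleftrightarrow> between (Arg2pi x) (Arg2pi y) (Arg2pi z)"
  unfolding between_def by (subst mem_pos_arc) auto

lemma open_arc_between:
  "x \<in> core \<Longrightarrow> y \<in> core \<Longrightarrow> z \<in> core \<Longrightarrow>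
    z \<in> open_arc x y \<longleftrightarrow> strictly_between (Arg2pi x) (Arg2pi y) (Arg2pi z)"
  unfolding strictly_between_def by (subst mem_open_arc) auto

text \<open>
  The arithmetic core of \<open>arc_inside_or_outside\<close>, for an arc with known orientation.
\<close>

lemma arc_in_one_side:
  assumes "x \<in> core" "y \<in> core" "u \<in> core" "v \<in> core" "u \<noteq> v" "u \<notin> pos_arc x y" "v \<notin> pos_arc x y"
  shows "pos_arc x y \<subseteq> open_arc u v \<or> pos_arc x y \<inter> open_arc u v = {}"
proof (rule ccontr)
  assume "\<not> ?thesis"
  then obtain z w where "z \<in> pos_arc x y" "z \<notin> open_arc u v" "w \<in> pos_arc x y" "w \<in> open_arc u v" by blast
  then show False using assms(6,7)
    unfolding mem_pos_arc[OF assms(1,2)] mem_open_arc[OF assms(3,4)]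
     using core_eq_iff_Arg2pi[OF assms(3,4)] assms(3-5)
    by (auto split: if_splits)
qed

lemma core_split:
  assumes "u \<in> core" "v \<in> core" "u \<noteq> v" "z \<in> core" "z \<noteq> u" "z \<noteq> v"
  shows "z \<in> open_arc u v \<longleftrightarrow> z \<notin> open_arc v u"
  using assms core_eq_iff_Arg2pi[of z u] core_eq_iff_Arg2pi[of z v] core_eq_iff_Arg2pi[of u v]
  by (auto simp: mem_open_arc split: if_splits)

lemma open_arc_nonempty:
  assumes "x \<in> core" "y \<in> core" "x \<noteq> y"
  shows "\<exists>z. z \<in> open_arc x y"
proof (cases "Arg2pi x \<le> Arg2pi y")
  case True
  then have "Arg2pi x < Arg2pi y" using core_eq_iff_Arg2pi assms by force
  moreover obtain z where "z \<in> core" "Arg2pi z = (Arg2pi x + Arg2pi y) / 2"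
    using exists_core_Arg2pi[of "(Arg2pi x + Arg2pi y) / 2"] Arg2pi[of x] Arg2pi[of y] by auto
  ultimately show ?thesis using assms by (intro exI[of _ z]) (auto simp: mem_open_arc)
next
  case False
  moreover obtain z where "z \<in> core" "Arg2pi z = (Arg2pi x + 2 * pi) / 2"
    using exists_core_Arg2pi[of "(Arg2pi x + 2 * pi) / 2"] Arg2pi[of x] by auto
  ultimately show ?thesis using assms Arg2pi[of x] by (intro exI[of _ z]) (auto simp: mem_open_arc)
qed

lemma sub_arc:
  assumes "x \<in> core" "y \<in> core" "p \<in> pos_arc x y" "q \<in> pos_arc x y" "p \<noteq> q"
  shows "pos_arc p q \<subseteq> pos_arc x y \<or> pos_arc q p \<subseteq> pos_arc x y"
proof (rule ccontr)
  have pq: "p \<in> core" "q \<in> core" using assms(3,4) by (auto simp: pos_arc_def)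
  assume "\<not> ?thesis"
  then obtain z w where "z \<in> pos_arc p q" "z \<notin> pos_arc x y" "w \<in> pos_arc q p" "w \<notin> pos_arc x y" by blast
  then show False using assms(3,4)
    unfolding mem_pos_arc[OF assms(1,2)] mem_pos_arc[OF pq] mem_pos_arc[OF pq(2,1)]
    using core_eq_iff_Arg2pi[OF pq] assms(5)
    by (auto split: if_splits)
qed

section \<open>The two arcs swept by the ends of a moving arrow\<close>

lemma ends_mem_pos_arc:
  assumes "x \<in> core" "y \<in> core" shows "x \<in> pos_arc x y" "y \<in> pos_arc x y"
  using assms by (auto simp: mem_pos_arc)

lemma arc_with_endsD:
  assumes "arc_with_ends I x y"
  shows "x \<in> core" "y \<in> core" "x \<noteq> y" "x \<in> I" "y \<in> I" "I \<subseteq> core"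
  using assms ends_mem_pos_arc pos_arc_subset_core unfolding arc_with_ends_def by blast+

lemma arc_with_ends_sym: "arc_with_ends I x y \<longleftrightarrow> arc_with_ends I y x"
  unfolding arc_with_ends_def by blast

text \<open>
  In this lemma and the next two, \<open>P\<close> and \<open>Q\<close> are the short arcs along which the ends \<open>x\<close>, \<open>y\<close>
  of an arrow move to \<open>x'\<close>, \<open>y'\<close>. When \<open>x\<close> moves forward, the arc from \<open>x\<close> to \<open>y\<close> gets shorter at
  its beginning, so the new position lies in the old arc; when it moves backward, the arc gets
  longer and the old position lies in the new arc. For \<open>y\<close> it is the other way round.
\<close>

lemma moved_ends:
  assumes P: "arc_with_ends P x x'" and Q: "arc_with_ends Q y y'" and disj: "P \<inter> Q = {}"
  shows "x \<noteq> y" "x' \<noteq> y'" "x \<noteq> y'" "x' \<noteq> y"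
    and "P = pos_arc x x' \<Longrightarrow> x' \<in> open_arc x y \<and> x \<notin> open_arc x' y'"
    and "P = pos_arc x' x \<Longrightarrow> x' \<notin> open_arc x y \<and> x \<in> open_arc x' y'"
    and "Q = pos_arc y y' \<Longrightarrow> y' \<notin> open_arc x y \<and> y \<in> open_arc x' y'"
    and "Q = pos_arc y' y \<Longrightarrow> y' \<in> open_arc x y \<and> y \<notin> open_arc x' y'"
proof -
  note [simp] = arc_with_endsD(1,2)[OF P, unfolded mem_sphere_0] arc_with_endsD(1,2)[OF Q, unfolded mem_sphere_0]
  have nin: "x \<notin> Q" "x' \<notin> Q" "y \<notin> P" "y' \<notin> P"
    using disj P Q arc_with_endsD by blast+
  then show "x \<noteq> y" "x' \<noteq> y'" "x \<noteq> y'" "x' \<noteq> y"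
    using arc_with_endsD[OF P] arc_with_endsD[OF Q] by blast+
  note ineq = this
  have ne: "Arg2pi x \<noteq> Arg2pi x'" "Arg2pi y \<noteq> Arg2pi y'"
    using arc_with_endsD(3)[OF P] arc_with_endsD(3)[OF Q] core_eq_iff_Arg2pi by auto
  show "x' \<in> open_arc x y \<and> x \<notin> open_arc x' y'" if "P = pos_arc x x'"
    using nin(3,4) ne unfolding that by (simp add: pos_arc_between open_arc_between)
      (smt (verit) between_def strictly_between_def)
  show "x' \<notin> open_arc x y \<and> x \<in> open_arc x' y'" if "P = pos_arc x' x"
    using nin(3,4) ne unfolding that by (simp add: pos_arc_between open_arc_between)
      (smt (verit) between_def strictly_between_def)
  show "y' \<notin> open_arc x y \<and> y \<in> open_arc x' y'" if "Q = pos_arc y y'"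
    using nin(1,2) ne unfolding that by (simp add: pos_arc_between open_arc_between)
      (smt (verit) between_def strictly_between_def)
  show "y' \<in> open_arc x y \<and> y \<notin> open_arc x' y'" if "Q = pos_arc y' y"
    using nin(1,2) ne unfolding that by (simp add: pos_arc_between open_arc_between)
      (smt (verit) between_def strictly_between_def)
qed

lemma moved_open_arc:
  assumes P: "arc_with_ends P x x'" and Q: "arc_with_ends Q y y'" and disj: "P \<inter> Q = {}"
    and z: "z \<notin> P" "z \<notin> Q"
  shows "z \<in> open_arc x y \<longleftrightarrow> z \<in> open_arc x' y'"
proof (cases "z \<in> core")
  case True
  note [simp] = arc_with_endsD(1,2)[OF P, unfolded mem_sphere_0] arc_with_endsD(1,2)[OF Q, unfolded mem_sphere_0]
    True[unfolded mem_sphere_0]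
  have nin: "x \<notin> Q" "x' \<notin> Q" "y \<notin> P" "y' \<notin> P"
    using disj P Q arc_with_endsD by blast+
  consider "P = pos_arc x x'" "Q = pos_arc y y'" | "P = pos_arc x x'" "Q = pos_arc y' y"
    | "P = pos_arc x' x" "Q = pos_arc y y'" | "P = pos_arc x' x" "Q = pos_arc y' y"
    using P Q unfolding arc_with_ends_def by blast
  then show ?thesis
    using nin z by cases (simp add: pos_arc_between open_arc_between,
      unfold between_def strictly_between_def, argo)+
qed (use open_arc_subset_core in blast)

text \<open>
  The complement of the intersection of the old and the new arc is a single arc, which runs from
  the first point of \<open>Q\<close> to the last point of \<open>P\<close>. Everything that happens near the ends of
  the moving arrow happens inside it.
\<close>

lemma complementary_arc:
  assumes P: "arc_with_ends P x x'" and Q: "arc_with_ends Q y y'" and disj: "P \<inter> Q = {}"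
  obtains u v where "u \<in> core" "v \<in> core" "u \<noteq> v" "P \<union> Q \<subseteq> pos_arc u v"
    "pos_arc u v \<inter> (open_arc x y \<inter> open_arc x' y') = {}"
proof -
  note c = arc_with_endsD(1,2)[OF P] arc_with_endsD(1,2)[OF Q]
  note c[unfolded mem_sphere_0, simp]
  have nin: "x \<notin> Q" "x' \<notin> Q" "y \<notin> P" "y' \<notin> P"
    using disj P Q arc_with_endsD by blast+
  have "\<exists>u v. u \<in> core \<and> v \<in> core \<and> u \<noteq> v \<and> P \<union> Q \<subseteq> pos_arc u v \<and>
    pos_arc u v \<inter> (open_arc x y \<inter> open_arc x' y') = {}"
  proof -
    consider "P = pos_arc x x'" "Q = pos_arc y y'" | "P = pos_arc x x'" "Q = pos_arc y' y"
      | "P = pos_arc x' x" "Q = pos_arc y y'" | "P = pos_arc x' x" "Q = pos_arc y' y"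
      using P Q unfolding arc_with_ends_def by blast
    then obtain u v where uv: "u = y \<and> Q = pos_arc y y' \<or> u = y' \<and> Q = pos_arc y' y"
      "v = x' \<and> P = pos_arc x x' \<or> v = x \<and> P = pos_arc x' x" by metis
    then have uvc: "u \<in> core" "v \<in> core" using c by auto
    note uvc[unfolded mem_sphere_0, simp]
    have "u \<noteq> v" using uv nin arc_with_endsD[OF P] by blast
    moreover have "z \<in> pos_arc u v" if "z \<in> P \<union> Q" for z
    proof -
      have zc: "z \<in> core" using that arc_with_endsD P Q by blast
      note zc[unfolded mem_sphere_0, simp]
      show ?thesis using nin that uv
        by (elim disjE conjE) (simp add: pos_arc_between open_arc_between,
          unfold between_def strictly_between_def, argo)+
    qed
    moreover have "z \<notin> open_arc x y \<or> z \<notin> open_arc x' y'" if "z \<in> pos_arc u v" for z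
    proof -
      have zc: "z \<in> core" using that pos_arc_subset_core by blast
      note zc[unfolded mem_sphere_0, simp]
      show ?thesis using nin that uv
        by (elim disjE conjE) (simp add: pos_arc_between open_arc_between,
          unfold between_def strictly_between_def, argo)+
    qed
    ultimately show ?thesis using uvc by (intro exI[of _ u] exI[of _ v]) blast
  qed
  then show ?thesis using that by blast
qed

section \<open>Elementary homotopies of strings\<close>

text \<open>
  An inner point divides an arc into two arcs, each of which avoids one of its ends. This
  gives the room needed to place an auxiliary arrow between the two positions of a sliding one.
\<close>

lemma split_arc:
  assumes "p \<in> core" "q \<in> core" "p \<noteq> q" "m \<in> open_arc p q"
  shows "pos_arc p m \<subseteq> pos_arc p q - {q}" "pos_arc m q \<subseteq> pos_arc p q - {p}"
proof -
  have m: "m \<in> core" using assms(4) open_arc_subset_core by blast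
  note [simp] = assms(1,2)[unfolded mem_sphere_0] m[unfolded mem_sphere_0]
  have ne: "Arg2pi p \<noteq> Arg2pi q" using assms core_eq_iff_Arg2pi by blast
  have "z \<in> pos_arc p q - {q}" if "z \<in> pos_arc p m" for z
  proof -
    have "z \<in> core" using that pos_arc_subset_core by blast
    note [simp] = this[unfolded mem_sphere_0]
    have "z = q \<longleftrightarrow> Arg2pi z = Arg2pi q" by (rule core_eq_iff_Arg2pi) auto
    then show ?thesis using that assms(4) ne
      by (simp add: pos_arc_between open_arc_between, unfold between_def strictly_between_def, argo)
  qed
  moreover have "z \<in> pos_arc p q - {p}" if "z \<in> pos_arc m q" for z
  proof -
    have "z \<in> core" using that pos_arc_subset_core by blast
    note [simp] = this[unfolded mem_sphere_0]
    have "z = p \<longleftrightarrow> Arg2pi z = Arg2pi p" by (rule core_eq_iff_Arg2pi) auto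
    then show ?thesis using that assms(4) ne
      by (simp add: pos_arc_between open_arc_between, unfold between_def strictly_between_def, argo)
  qed
  ultimately show "pos_arc p m \<subseteq> pos_arc p q - {q}" "pos_arc m q \<subseteq> pos_arc p q - {p}" by blast+
qed

definition is_arc :: "complex set \<Rightarrow> bool" where
  "is_arc K \<longleftrightarrow> (\<exists>u v. arc_with_ends K u v)"

lemma is_arc_pos_arc: "u \<in> core \<Longrightarrow> v \<in> core \<Longrightarrow> u \<noteq> v \<Longrightarrow> is_arc (pos_arc u v)"
  unfolding is_arc_def arc_with_ends_def by blast

lemma is_arc_subset_core: "is_arc K \<Longrightarrow> K \<subseteq> core"
  unfolding is_arc_def using arc_with_endsD(6) by blast

lemma is_arc_sub_arc:
  assumes "is_arc K" "p \<in> K" "q \<in> K" "p \<noteq> q"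
  obtains I where "arc_with_ends I p q" "I \<subseteq> K"
proof -
  have "p \<in> core" "q \<in> core" using assms is_arc_subset_core by blast+
  then show ?thesis using assms sub_arc that unfolding is_arc_def arc_with_ends_def by metis
qed

lemma is_arc_midpoint:
  assumes K: "is_arc K" "p \<in> K" "q \<in> K" "p \<noteq> q"
  obtains m I J where "m \<noteq> p" "m \<noteq> q" "arc_with_ends I p m" "I \<subseteq> K - {q}" "arc_with_ends J q m" "J \<subseteq> K - {p}"
proof -
  have *: "\<exists>m I J. m \<noteq> p \<and> m \<noteq> q \<and> arc_with_ends I p m \<and> I \<subseteq> K - {q} \<and> arc_with_ends J q m \<and> J \<subseteq> K - {p}"
    if "pos_arc p q \<subseteq> K" "p \<in> core" "q \<in> core" "p \<noteq> q" for p q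
  proof -
    obtain m where m: "m \<in> open_arc p q" using open_arc_nonempty \<open>p \<in> core\<close> \<open>q \<in> core\<close> \<open>p \<noteq> q\<close> by blast
    then have "m \<in> core" "m \<noteq> p" "m \<noteq> q" by (auto simp: open_arc_def pos_arc_def)
    then show ?thesis using split_arc[OF that(2-4) m] that
      unfolding arc_with_ends_def
      by (intro exI[of _ m] exI[of _ "pos_arc p m"] exI[of _ "pos_arc m q"]) auto
  qed
  obtain L where "arc_with_ends L p q" "L \<subseteq> K" using is_arc_sub_arc K by blast
  then have c: "pos_arc p q \<subseteq> K \<or> pos_arc q p \<subseteq> K" "p \<in> core" "q \<in> core" 
    by (auto simp: arc_with_ends_def)
  then show ?thesis using *[of p q] *[of q p] K(4) that by metis
qed

lemma is_arc_third_point: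
  assumes "is_arc K" "p \<in> K" "q \<in> K"
  obtains m where "m \<in> K" "m \<noteq> p" "m \<noteq> q"
proof (cases "p = q")
  case True
  obtain u v where "arc_with_ends K u v" using assms(1) is_arc_def by blast
  then show ?thesis using arc_with_endsD[of K u v] True that by metis
next
  case False
  then show ?thesis using is_arc_midpoint[OF assms False] arc_with_endsD that by (metis DiffD1 subsetD)
qed

definition ends :: "arrow set \<Rightarrow> complex set" where
  "ends A = fst ` A \<union> snd ` A"

lemma endpoints_eq_ends: "endpoints \<alpha> = ends (arr \<alpha>)"
  by (simp add: endpoints_def ends_def)

lemma ends_simps [simp]:
  "ends {} = {}" "ends (insert (a, b) A) = insert a (insert b (ends A))" "ends (A \<union> B) = ends A \<union> ends B"
  by (auto simp: ends_def)

lemma ends_mono: "A \<subseteq> B \<Longrightarrow> ends A \<subseteq> ends B"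
  by (auto simp: ends_def)

lemma is_virtual_string_arr: "is_virtual_string (arr \<alpha>)"
  using arr by auto

lemma is_virtual_string_subset: "is_virtual_string B \<Longrightarrow> A \<subseteq> B \<Longrightarrow> is_virtual_string A"
  unfolding is_virtual_string_def by (blast intro: finite_subset)

lemma is_virtual_string_insert:
  assumes "is_virtual_string A" "a \<in> core" "b \<in> core" "a \<noteq> b" "a \<notin> ends A" "b \<notin> ends A"
  shows "is_virtual_string (insert (a, b) A)"
proof -
  have "{fst e, snd e} \<subseteq> ends A" if "e \<in> A" for e
    using that by (auto simp: ends_def)
  then have "\<forall>e\<in>A. a \<noteq> fst e \<and> fst e \<noteq> a \<and> a \<noteq> snd e \<and> snd e \<noteq> a \<and>
      b \<noteq> fst e \<and> fst e \<noteq> b \<and> b \<noteq> snd e \<and> snd e \<noteq> b"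
    using assms(5,6) by blast
  then show ?thesis
    using assms(1-4) unfolding is_virtual_string_def by simp
qed

lemma obtain_vstring:
  assumes "is_virtual_string A" obtains \<alpha> where "arr \<alpha> = A"
  using assms Vstring_inverse by blast

lemma move_imp_homotopic: "move \<alpha> \<beta> \<Longrightarrow> homotopic_strings \<alpha> \<beta>"
  unfolding homotopic_strings_def by (rule r_into_equivclp)

lemma homotopic_refl: "homotopic_strings \<alpha> \<alpha>"
  unfolding homotopic_strings_def by simp

lemma homotopic_sym: "homotopic_strings \<alpha> \<beta> \<Longrightarrow> homotopic_strings \<beta> \<alpha>"
  unfolding homotopic_strings_def by (rule equivclp_sym)

lemma homotopic_trans: "homotopic_strings \<alpha> \<beta> \<Longrightarrow> homotopic_strings \<beta> \<gamma> \<Longrightarrow> homotopic_strings \<alpha> \<gamma>"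
  unfolding homotopic_strings_def by (rule equivclp_trans)

text \<open>
  The hypothesis is symmetric in \<open>p\<close> and \<open>q\<close> and speaks of a larger arc, so that it can be used
  without knowing in which order the two points occur.
\<close>

lemma isolated_arrow:
  assumes "is_arc K" "K \<inter> endpoints \<gamma> = {}" "p \<in> K" "q \<in> K" "p \<noteq> q"
    and "arr \<alpha> = insert (p, q) (arr \<gamma>)"
  shows "homotopic_strings \<gamma> \<alpha>"
proof -
  obtain I where I: "arc_with_ends I p q" "I \<subseteq> K" using is_arc_sub_arc assms by blast
  then have "type1_move \<gamma> \<alpha>"
    using assms unfolding arc_with_ends_def
    by (metis disjoint_iff subsetD type1_move.intros)
  then show ?thesis using move_imp_homotopic move_def by blast
qed

lemma opposite_arrows:
  assumes "is_arc K" "is_arc L" "K \<inter> L = {}" "(K \<union> L) \<inter> endpoints \<gamma> = {}"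
    and "p \<in> K" "p' \<in> K" "p \<noteq> p'" "q \<in> L" "q' \<in> L" "q \<noteq> q'"
    and "arr \<alpha> = arr \<gamma> \<union> {(p, q), (q', p')}"
  shows "homotopic_strings \<gamma> \<alpha>"
proof -
  obtain I where I: "arc_with_ends I p p'" "I \<subseteq> K" using is_arc_sub_arc assms by blast
  obtain J where J: "arc_with_ends J q q'" "J \<subseteq> L" using is_arc_sub_arc assms by blast
  have "type2_move \<gamma> \<alpha>"
    using I J assms by (intro type2_move.intros[of I p p' J q q']) auto
  then show ?thesis using move_imp_homotopic move_def by blast
qed

text \<open>
  The slide is the composition of two moves of type 2 through a string \<open>\<delta>\<close> that contains the old
  arrow, the new arrow and an arrow in the opposite direction whose ends \<open>n\<close>, \<open>m\<close> lie
  between those of the other two. The opposite arrow forms a cancelling pair with either of them.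
\<close>

lemma slide_arrow_distinct:
  assumes K: "is_arc K" and L: "is_arc L" and KL: "K \<inter> L = {}" "(K \<union> L) \<inter> ends G = {}"
    and p: "p \<in> K" "p' \<in> K" "p \<noteq> p'" and q: "q \<in> L" "q' \<in> L" "q \<noteq> q'"
    and \<alpha>: "arr \<alpha> = insert (p, q) G" and \<beta>: "arr \<beta> = insert (p', q') G"
  shows "homotopic_strings \<alpha> \<beta>"
proof -
  obtain m I I' where m: "m \<noteq> p" "m \<noteq> p'" "arc_with_ends I p m" "I \<subseteq> K - {p'}" 
    "arc_with_ends I' p' m" "I' \<subseteq> K - {p}" using is_arc_midpoint[OF K p] by blast
  obtain n J J' where n: "n \<noteq> q" "n \<noteq> q'" "arc_with_ends J q n" "J \<subseteq> L - {q'}" 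
    "arc_with_ends J' q' n" "J' \<subseteq> L - {q}" using is_arc_midpoint[OF L q] by blast
  have mn: "m \<in> K" "n \<in> L" using m(4) n(4) arc_with_endsD(5)[OF m(3)] arc_with_endsD(5)[OF n(3)] by auto
  then have "m \<noteq> n" using KL by blast
  have core: "K \<subseteq> core" "L \<subseteq> core" using K L is_arc_subset_core by auto
  have G: "is_virtual_string G" using \<alpha> is_virtual_string_arr is_virtual_string_subset by (metis subset_insertI)
  have "is_virtual_string (insert (p', q') (insert (n, m) (insert (p, q) G)))"
    using mn p q KL core m(1,2) n(1,2)
    by (intro is_virtual_string_insert G) auto
  then obtain \<delta> where \<delta>: "arr \<delta> = insert (p', q') (insert (n, m) (insert (p, q) G))" 
    by (rule obtain_vstring)
  have "type2_move \<alpha> \<delta>"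
    using m n KL p q by (intro type2_move.intros[OF m(5) n(5)])
      (auto simp: \<alpha> \<delta> endpoints_eq_ends)
  moreover have "type2_move \<beta> \<delta>"
    using m n KL p q by (intro type2_move.intros[OF m(3) n(3)])
      (auto simp: \<beta> \<delta> endpoints_eq_ends)
  ultimately show ?thesis
    using move_imp_homotopic move_def homotopic_sym homotopic_trans by metis
qed

text \<open>
  When the old and the new arrow share an end, there is no room between them, so the slide goes
  through a third position.
\<close>

lemma slide_arrow:
  assumes K: "is_arc K" and L: "is_arc L" and KL: "K \<inter> L = {}" "(K \<union> L) \<inter> ends G = {}"
    and p: "p \<in> K" "p' \<in> K" and q: "q \<in> L" "q' \<in> L"
    and \<alpha>: "arr \<alpha> = insert (p, q) G" and \<beta>: "arr \<beta> = insert (p', q') G"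
  shows "homotopic_strings \<alpha> \<beta>"
proof -
  obtain m where m: "m \<in> K" "m \<noteq> p" "m \<noteq> p'" using is_arc_third_point[OF K p] by blast
  obtain n where n: "n \<in> L" "n \<noteq> q" "n \<noteq> q'" using is_arc_third_point[OF L q] by blast
  have core: "K \<subseteq> core" "L \<subseteq> core" using K L is_arc_subset_core by auto
  have G: "is_virtual_string G" using \<alpha> is_virtual_string_arr is_virtual_string_subset by (metis subset_insertI)
  have "is_virtual_string (insert (m, n) G)"
    using m n KL core by (intro is_virtual_string_insert G) auto
  then obtain \<delta> where \<delta>: "arr \<delta> = insert (m, n) G" by (rule obtain_vstring)
  show ?thesis
    using slide_arrow_distinct[OF K L KL _ _ _ _ _ _ \<alpha> \<delta>] slide_arrow_distinct[OF K L KL _ _ _ _ _ _ \<beta> \<delta>]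
      m n p q homotopic_sym homotopic_trans by metis
qed

section \<open>Cutting a string along a fixed arrow\<close>

abbreviation arrows_in :: "arrow set \<Rightarrow> complex set \<Rightarrow> arrow set" where
  "arrows_in A X \<equiv> {e \<in> A. fst e \<in> X \<and> snd e \<in> X}"

lemma arr_restrict: "arr (restrict_string \<alpha> X) = arrows_in (arr \<alpha>) X"
  by (rule restrict_string.rep_eq)

lemma ends_arrows_in: "ends (arrows_in A X) \<subseteq> ends A \<inter> X"
  by (auto simp: ends_def)

lemma vstring_eqI: "arr \<alpha> = arr \<beta> \<Longrightarrow> \<alpha> = \<beta>"
  by (simp add: arr_inject)

lemma homotopic_eqI: "arr \<alpha> = arr \<beta> \<Longrightarrow> homotopic_strings \<alpha> \<beta>"
  using vstring_eqI homotopic_refl by metis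

lemma endpoints_subset_core: "endpoints \<alpha> \<subseteq> core"
  using is_virtual_string_arr[of \<alpha>] by (auto simp: endpoints_def is_virtual_string_def)

lemma endpoints_restrict: "endpoints (restrict_string \<alpha> X) \<subseteq> endpoints \<alpha> \<inter> X"
  unfolding endpoints_eq_ends arr_restrict by (rule ends_arrows_in)

lemma arrow_ends:
  assumes "d \<in> arr \<alpha>"
  shows "fst d \<in> endpoints \<alpha>" "snd d \<in> endpoints \<alpha>" "fst d \<noteq> snd d" "fst d \<in> core" "snd d \<in> core"
  using assms is_virtual_string_arr[of \<alpha>] by (auto simp: endpoints_def is_virtual_string_def)

text \<open>
  A connected set that avoids the two ends of an arc is either contained in it or disjoint from
  it. This is what localises a move on one side of an arrow.
\<close>

lemma arc_inside_or_outside: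
  assumes "arc_with_ends I p q" "u \<in> core" "v \<in> core" "u \<noteq> v" "u \<notin> I" "v \<notin> I"
  shows "I \<subseteq> open_arc u v \<or> I \<inter> open_arc u v = {}"
  using assms arc_in_one_side unfolding arc_with_ends_def by metis

lemma type1_move_sides:
  assumes "type1_move \<alpha> \<beta>" and u: "u \<in> endpoints \<alpha>" "v \<in> endpoints \<alpha>" "u \<noteq> v"
  shows "homotopic_strings (restrict_string \<alpha> (open_arc u v)) (restrict_string \<beta> (open_arc u v))"
  using assms(1)
proof cases
  case (1 a b)
  define X where "X = open_arc u v"
  have I: "arc_with_ends (pos_arc a b) a b" using 1 by (auto simp: arc_with_ends_def)
  note ab = arc_with_endsD(4,5)[OF I]
  have "pos_arc a b \<subseteq> X \<or> pos_arc a b \<inter> X = {}"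
    unfolding X_def using u 1(4) endpoints_subset_core[of \<alpha>]
    by (intro arc_inside_or_outside[OF I]) auto
  then consider "pos_arc a b \<subseteq> X" | "pos_arc a b \<inter> X = {}" by blast
  then have "homotopic_strings (restrict_string \<alpha> X) (restrict_string \<beta> X)"
  proof cases
    case 1
    then have "arr (restrict_string \<beta> X) = insert (a, b) (arr (restrict_string \<alpha> X)) \<or>
      arr (restrict_string \<beta> X) = insert (b, a) (arr (restrict_string \<alpha> X))"
      using \<open>arr \<beta> = _ \<or> _\<close> ab unfolding arr_restrict by auto
    moreover have "is_arc (pos_arc a b)" using I is_arc_def by blast
    moreover have "pos_arc a b \<inter> endpoints (restrict_string \<alpha> X) = {}"
      using endpoints_restrict \<open>pos_arc a b \<inter> endpoints \<alpha> = {}\<close> by blast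
    ultimately show ?thesis
      using isolated_arrow ab \<open>a \<noteq> b\<close> by metis
  next
    case 2
    then have "arr (restrict_string \<beta> X) = arr (restrict_string \<alpha> X)"
      using \<open>arr \<beta> = _ \<or> _\<close> ab unfolding arr_restrict by auto
    then show ?thesis using homotopic_eqI by metis
  qed
  then show ?thesis by (simp add: X_def)
qed

lemma type2_move_sides:
  assumes "type2_move \<alpha> \<beta>" and u: "u \<in> endpoints \<alpha>" "v \<in> endpoints \<alpha>" "u \<noteq> v"
  shows "homotopic_strings (restrict_string \<alpha> (open_arc u v)) (restrict_string \<beta> (open_arc u v))"
  using assms(1)
proof cases
  case (1 I a a' J b b')
  define X where "X = open_arc u v"
  note ab = arc_with_endsD(3-5)[OF 1(1)] arc_with_endsD(3-5)[OF 1(2)]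
  have IX: "I \<subseteq> X \<or> I \<inter> X = {}"
    unfolding X_def using u 1(4) endpoints_subset_core[of \<alpha>]
    by (intro arc_inside_or_outside[OF 1(1)]) auto
  have JX: "J \<subseteq> X \<or> J \<inter> X = {}"
    unfolding X_def using u 1(5) endpoints_subset_core[of \<alpha>]
    by (intro arc_inside_or_outside[OF 1(2)]) auto
  have "homotopic_strings (restrict_string \<alpha> X) (restrict_string \<beta> X)"
  proof (cases "I \<subseteq> X \<and> J \<subseteq> X")
    case True
    have "arr (restrict_string \<beta> X) = arr (restrict_string \<alpha> X) \<union> {(a, b), (b', a')}"
      unfolding arr_restrict 1(6) using True ab by auto
    moreover have "is_arc I" "is_arc J" using 1(1,2) is_arc_def by blast+
    moreover have "(I \<union> J) \<inter> endpoints (restrict_string \<alpha> X) = {}"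
      using endpoints_restrict 1(4,5) by blast
    ultimately show "homotopic_strings (restrict_string \<alpha> X) (restrict_string \<beta> X)"
      using opposite_arrows[OF _ _ 1(3)] ab by metis
  next
    case False
    then have "arr (restrict_string \<beta> X) = arr (restrict_string \<alpha> X)"
      unfolding arr_restrict 1(6) using IX JX ab by auto
    then show "homotopic_strings (restrict_string \<alpha> X) (restrict_string \<beta> X)" using homotopic_eqI by metis
  qed
  then show ?thesis by (simp add: X_def)
qed

text \<open>
  The three closed arcs of a move of type 3 contain no end of an arrow outside the triangle: their
  interiors are free by assumption, and all six boundary points are ends of the three arrows of
  the triangle.
\<close>

lemma type3_moveE:
  assumes "type3_move \<alpha> R \<beta>"
  obtains G a a' b b' c c' where
    "arc_with_ends (pos_arc a a') a a'" "arc_with_ends (pos_arc b b') b b'" "arc_with_ends (pos_arc c c') c c'"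
    "pos_arc a a' \<inter> pos_arc b b' = {}" "pos_arc b b' \<inter> pos_arc c c' = {}" "pos_arc c c' \<inter> pos_arc a a' = {}"
    "R = {((a', b), (a, b')), ((b', c), (b, c')), ((c', a), (c, a'))} \<or>
        R = {((a, b), (a', b')), ((a', c), (a, c')), ((b', c'), (b, c))}"
    "fst ` R \<subseteq> arr \<alpha>" "G = arr \<alpha> - fst ` R"
    "arr \<alpha> = G \<union> fst ` R" "arr \<beta> = G \<union> snd ` R" "is_virtual_string G"
    "ends G \<inter> pos_arc a a' = {}" "ends G \<inter> pos_arc b b' = {}" "ends G \<inter> pos_arc c c' = {}"
  using assms
proof cases
  case (1 a a' b b' c c')
  define G where "G = arr \<alpha> - fst ` R"
  have "ends (fst ` R) = {a, a', b, b', c, c'}"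
    using 1(9) by (auto simp: ends_def)
  moreover have "ends G \<inter> ends (fst ` R) = {}"
  proof -
    have "{fst e, snd e} \<inter> {fst f, snd f} = {}" if "e \<in> G" "f \<in> fst ` R" for e f
      using that 1(10) is_virtual_string_arr[of \<alpha>] unfolding G_def is_virtual_string_def by blast
    then show ?thesis unfolding ends_def by blast
  qed
  moreover have "ends G \<subseteq> endpoints \<alpha>" unfolding endpoints_eq_ends G_def by (intro ends_mono) blast
  ultimately have "ends G \<inter> pos_arc a a' = {}" "ends G \<inter> pos_arc b b' = {}" "ends G \<inter> pos_arc c c' = {}"
    using 1(8) unfolding open_arc_def by blast+
  moreover have "is_virtual_string G" using is_virtual_string_arr is_virtual_string_subset G_def by (metis Diff_subset)
  moreover have "arr \<alpha> = G \<union> fst ` R" using 1(10) G_def by blast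
  moreover have "arr \<beta> = G \<union> snd ` R" using 1(11) G_def by blast
  moreover have "arc_with_ends (pos_arc a a') a a'" "arc_with_ends (pos_arc b b') b b'" "arc_with_ends (pos_arc c c') c c'"
    using 1(1-4) by (auto simp: arc_with_ends_def)
  ultimately show ?thesis using that[OF _ _ _ 1(5-7,9,10) G_def] by blast
qed

text \<open>
  The version of \<open>slide_arrow\<close> for one side \<open>X\<close> of a fixed arrow. Each arc lies inside or outside
  \<open>X\<close>, so the arrow is kept before the slide if and only if it is kept after it.
\<close>

lemma slide_arrow_in:
  assumes "is_arc K" "is_arc L" "K \<inter> L = {}" "(K \<union> L) \<inter> ends G = {}"
    and "p \<in> K" "p' \<in> K" "q \<in> L" "q' \<in> L"
    and "K \<subseteq> X \<or> K \<inter> X = {}" "L \<subseteq> X \<or> L \<inter> X = {}"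
    and "arr \<alpha> = arrows_in (insert (p, q) G) X" "arr \<beta> = arrows_in (insert (p', q') G) X"
  shows "homotopic_strings \<alpha> \<beta>"
proof (cases "K \<subseteq> X \<and> L \<subseteq> X")
  case True
  then have ab: "arr \<alpha> = insert (p, q) (arrows_in G X)" "arr \<beta> = insert (p', q') (arrows_in G X)"
    using assms by auto
  have "(K \<union> L) \<inter> ends (arrows_in G X) = {}" using ends_arrows_in assms(4) by blast
  then show ?thesis by (rule slide_arrow[OF assms(1-3) _ assms(5-8) ab])
next
  case False
  then have "arr \<alpha> = arr \<beta>" using assms(5-12) by auto
  then show ?thesis by (rule homotopic_eqI)
qed

text \<open>
  Every arrow of the triangle joins two of the three arcs. If all three arcs lie on the side in
  question, the triangle survives and the move is still a move of type 3. Otherwise at most one of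
  the three arrows survives, because every arc meets two of them, and the move slides it.
\<close>

lemma type3_move_sides:
  assumes R: "type3_move \<alpha> R \<beta>" and d: "d \<in> arr \<alpha>" "d \<notin> fst ` R"
    and u: "u \<in> {fst d, snd d}" "v \<in> {fst d, snd d}" "u \<noteq> v"
  shows "homotopic_strings (restrict_string \<alpha> (open_arc u v)) (restrict_string \<beta> (open_arc u v))"
proof -
  define X where "X = open_arc u v"
  obtain G a a' b b' c c' where
    A: "arc_with_ends (pos_arc a a') a a'" "arc_with_ends (pos_arc b b') b b'" "arc_with_ends (pos_arc c c') c c'"
    and disj: "pos_arc a a' \<inter> pos_arc b b' = {}" "pos_arc b b' \<inter> pos_arc c c' = {}" "pos_arc c c' \<inter> pos_arc a a' = {}"
    and Rcases: "R = {((a', b), (a, b')), ((b', c), (b, c')), ((c', a), (c, a'))} \<or>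
        R = {((a, b), (a', b')), ((a', c), (a, c')), ((b', c'), (b, c))}"
    and fR: "fst ` R \<subseteq> arr \<alpha>" and G: "G = arr \<alpha> - fst ` R"
    and arr: "arr \<alpha> = G \<union> fst ` R" "arr \<beta> = G \<union> snd ` R" 
    and Gends: "ends G \<inter> pos_arc a a' = {}" "ends G \<inter> pos_arc b b' = {}" "ends G \<inter> pos_arc c c' = {}"
    using type3_moveE[OF R] by metis
  have "{fst d, snd d} \<subseteq> ends G" using d G by (auto simp: ends_def)
  then have uv: "u \<in> ends G" "v \<in> ends G" "u \<in> core" "v \<in> core"
    using u arrow_ends[OF d(1)] by auto
  have "I \<subseteq> X \<or> I \<inter> X = {}" if "arc_with_ends I p q" "ends G \<inter> I = {}" for I p q
    unfolding X_def using that uv u(3) by (intro arc_inside_or_outside) auto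
  then have side: "pos_arc a a' \<subseteq> X \<or> pos_arc a a' \<inter> X = {}" "pos_arc b b' \<subseteq> X \<or> pos_arc b b' \<inter> X = {}"
    "pos_arc c c' \<subseteq> X \<or> pos_arc c c' \<inter> X = {}"
    using A Gends by blast+
  note mem = arc_with_endsD(4,5)[OF A(1)] arc_with_endsD(4,5)[OF A(2)] arc_with_endsD(4,5)[OF A(3)]
  note ne = arc_with_endsD(3)[OF A(1)] arc_with_endsD(3)[OF A(2)] arc_with_endsD(3)[OF A(3)]
  have isarc: "is_arc (pos_arc a a')" "is_arc (pos_arc b b')" "is_arc (pos_arc c c')"
    using A is_arc_def by blast+
  have arc2: "(pos_arc a a' \<union> pos_arc b b') \<inter> ends G = {}" "(pos_arc b b' \<union> pos_arc c c') \<inter> ends G = {}"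
    "(pos_arc a a' \<union> pos_arc c c') \<inter> ends G = {}"
    using Gends by blast+
  note slide_bc = slide_arrow_in[OF isarc(2,3) disj(2) arc2(2) _ _ _ _ side(2,3)]
  have disj13: "pos_arc a a' \<inter> pos_arc c c' = {}" using disj(3) by blast
  note slide_ab = slide_arrow_in[OF isarc(1,2) disj(1) arc2(1) _ _ _ _ side(1,2)]
  note slide_ac = slide_arrow_in[OF isarc(1,3) disj13 arc2(3) _ _ _ _ side(1,3)]
  note slide_ca = slide_arrow_in[OF isarc(3,1) disj(3) _ _ _ _ _ side(3,1)]
  consider "pos_arc a a' \<inter> X = {}" | "pos_arc b b' \<inter> X = {}" | "pos_arc c c' \<inter> X = {}"
    | "pos_arc a a' \<subseteq> X" "pos_arc b b' \<subseteq> X" "pos_arc c c' \<subseteq> X"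
    using side by blast
  then have "homotopic_strings (restrict_string \<alpha> X) (restrict_string \<beta> X)"
  proof cases
    case 1
    then have *: "a \<notin> X" "a' \<notin> X" using mem by auto
    from Rcases show ?thesis
    proof
      assume "R = {((a', b), (a, b')), ((b', c), (b, c')), ((c', a), (c, a'))}"
      then show ?thesis using * mem
        by (intro slide_bc[of b' b c c']) (auto simp: arr_restrict arr)
    next
      assume "R = {((a, b), (a', b')), ((a', c), (a, c')), ((b', c'), (b, c))}"
      then show ?thesis using * mem
        by (intro slide_bc[of b' b c' c]) (auto simp: arr_restrict arr)
    qed
  next
    case 2
    then have *: "b \<notin> X" "b' \<notin> X" using mem by auto
    from Rcases show ?thesis
    proof
      assume "R = {((a', b), (a, b')), ((b', c), (b, c')), ((c', a), (c, a'))}"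
      then show ?thesis using * mem arc2(3)
        by (intro slide_ca[of G c' c a a']) (auto simp: arr_restrict arr)
    next
      assume "R = {((a, b), (a', b')), ((a', c), (a, c')), ((b', c'), (b, c))}"
      then show ?thesis using * mem
        by (intro slide_ac[of a' a c c']) (auto simp: arr_restrict arr)
    qed
  next
    case 3
    then have *: "c \<notin> X" "c' \<notin> X" using mem by auto
    from Rcases show ?thesis
    proof
      assume "R = {((a', b), (a, b')), ((b', c), (b, c')), ((c', a), (c, a'))}"
      then show ?thesis using * mem
        by (intro slide_ab[of a' a b b']) (auto simp: arr_restrict arr)
    next
      assume "R = {((a, b), (a', b')), ((a', c), (a, c')), ((b', c'), (b, c))}"
      then show ?thesis using * mem
        by (intro slide_ab[of a a' b b']) (auto simp: arr_restrict arr)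
    qed
  next
    case 4
    then have pts: "{a, a', b, b', c, c'} \<subseteq> X" using mem by auto
    have RX: "fst ` R \<subseteq> arr (restrict_string \<alpha> X)"
      using fR Rcases pts by (auto simp: arr_restrict)
    have "snd ` R = arrows_in (snd ` R) X"
      using Rcases pts by auto
    then have RX2: "arr (restrict_string \<beta> X) = arr (restrict_string \<alpha> X) - fst ` R \<union> snd ` R"
      unfolding arr_restrict using G arr(2) by blast
    have op: "(open_arc a a' \<union> open_arc b b' \<union> open_arc c c') \<inter> endpoints (restrict_string \<alpha> X) = {}"
    proof -
      have "endpoints \<alpha> \<subseteq> ends G \<union> {a, a', b, b', c, c'}"
        unfolding endpoints_eq_ends arr(1) using Rcases by (auto simp: ends_def)
      moreover have "{a, a', b, b', c, c'} \<inter> (open_arc a a' \<union> open_arc b b' \<union> open_arc c c') = {}"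
        using disj mem unfolding open_arc_def by blast
      moreover have "ends G \<inter> (open_arc a a' \<union> open_arc b b' \<union> open_arc c c') = {}"
        using Gends unfolding open_arc_def by blast
      ultimately show ?thesis using endpoints_restrict by blast
    qed
    have core: "{a, a', b, b', c, c'} \<subseteq> core" using arc_with_endsD(1,2) A by blast
    have "type3_move (restrict_string \<alpha> X) R (restrict_string \<beta> X)"
      by (rule type3_move.intros[OF core ne disj op Rcases RX RX2])
    then show ?thesis using move_imp_homotopic move_def by blast
  qed
  then show ?thesis by (simp add: X_def)
qed

section \<open>Cutting a string along a moving arrow\<close>

text \<open>
  The string \<open>\<gamma>\<close> is the part that the side of the arrow before and after it moves have in common;
  it consists of stationary arrows only. The two sides differ from it by arrows that have an end in
  the arc \<open>K\<close>, which contains no end of \<open>\<gamma>\<close>.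
\<close>

lemma common_side:
  assumes P: "arc_with_ends P x x'" and Q: "arc_with_ends Q y y'" and disj: "P \<inter> Q = {}"
    and G: "is_virtual_string G" "ends G \<inter> (P \<union> Q) = {}"
  obtains K \<gamma> where "is_arc K" "P \<union> Q \<subseteq> K" "K \<inter> (open_arc x y \<inter> open_arc x' y') = {}"
    "arr \<gamma> = arrows_in G (open_arc x y)" "arr \<gamma> = arrows_in G (open_arc x' y')"
    "endpoints \<gamma> \<inter> K = {}" "endpoints \<gamma> \<subseteq> ends G"
proof -
  obtain u v where K: "u \<in> core" "v \<in> core" "u \<noteq> v" "P \<union> Q \<subseteq> pos_arc u v"
    "pos_arc u v \<inter> (open_arc x y \<inter> open_arc x' y') = {}"
    using complementary_arc[OF P Q disj] by blast
  have "is_virtual_string (arrows_in G (open_arc x y))"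
    by (rule is_virtual_string_subset[OF G(1)]) blast
  then obtain \<gamma> where \<gamma>: "arr \<gamma> = arrows_in G (open_arc x y)" by (rule obtain_vstring)
  have iff: "z \<in> open_arc x y \<longleftrightarrow> z \<in> open_arc x' y'" if "z \<in> ends G" for z
    using moved_open_arc[OF P Q disj] that G(2) by blast
  have "fst e \<in> ends G" "snd e \<in> ends G" if "e \<in> G" for e using that by (auto simp: ends_def)
  then have \<gamma>': "arr \<gamma> = arrows_in G (open_arc x' y')" using \<gamma> iff by blast
  have sub: "endpoints \<gamma> \<subseteq> ends G \<inter> (open_arc x y \<inter> open_arc x' y')"
    using ends_arrows_in[of G "open_arc x y", folded \<gamma>] ends_arrows_in[of G "open_arc x' y'", folded \<gamma>']
    unfolding endpoints_eq_ends by blast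
  show ?thesis
    by (rule that[OF is_arc_pos_arc[OF K(1-3)] K(4,5) \<gamma> \<gamma>']) (use sub K(5) in blast)+
qed

text \<open>
  The second of the two arrows may have both ends on the chosen side of the first one, or vice
  versa. These ends are then the outermost points of that side, so that they are adjacent through the
  other side, and the arrow can be removed by a move of type 1.
\<close>

lemma parallel_arrows_sides:
  assumes P: "arc_with_ends P x x'" and Q: "arc_with_ends Q y y'" and disj: "P \<inter> Q = {}"
    and int: "(P - {x, x'}) \<inter> endpoints \<alpha> = {}" "(Q - {y, y'}) \<inter> endpoints \<alpha> = {}"
    and d: "d \<in> arr \<alpha>" "d = (x, y) \<or> d = (y, x)" and d': "d' \<in> arr \<alpha>" "d' = (x', y') \<or> d' = (y', x')"
  shows "homotopic_strings (restrict_string \<alpha> (open_arc x y)) (restrict_string \<alpha> (open_arc x' y'))"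
proof -
  define G where "G = arr \<alpha> - {d, d'}"
  note c = arc_with_endsD[OF P] arc_with_endsD[OF Q]
  have Gvs: "is_virtual_string G" using is_virtual_string_arr is_virtual_string_subset G_def by (metis Diff_subset)
  have "ends G \<inter> ends {d, d'} = {}"
  proof -
    have "{fst e, snd e} \<inter> {fst f, snd f} = {}" if "e \<in> G" "f \<in> {d, d'}" for e f
      using that d(1) d'(1) is_virtual_string_arr[of \<alpha>] unfolding G_def is_virtual_string_def by blast
    then show ?thesis unfolding ends_def by blast
  qed
  moreover have "ends {d, d'} = {x, x', y, y'}" using d(2) d'(2) by auto
  moreover have "ends G \<subseteq> endpoints \<alpha>" unfolding endpoints_eq_ends G_def by (intro ends_mono) blast
  ultimately have Gends: "ends G \<inter> (P \<union> Q) = {}"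
    using int by blast
  obtain K \<gamma> where K: "is_arc K" "P \<union> Q \<subseteq> K" "K \<inter> (open_arc x y \<inter> open_arc x' y') = {}"
    and \<gamma>: "arr \<gamma> = arrows_in G (open_arc x y)" "arr \<gamma> = arrows_in G (open_arc x' y')"
    and e: "endpoints \<gamma> \<inter> K = {}" "endpoints \<gamma> \<subseteq> ends G"
    using common_side[OF P Q disj Gvs Gends] by blast
  have e': "K \<inter> endpoints \<gamma> = {}" using e by blast
  have one: "homotopic_strings \<gamma> \<delta>" if "f \<in> {d, d'}" "arr \<delta> = insert f (arr \<gamma>)" for f \<delta>
  proof -
    have "fst f \<in> K" "snd f \<in> K" using that(1) d(2) d'(2) c K(2) by auto
    moreover have "fst f \<noteq> snd f" using that(1) d(1) d'(1) arrow_ends(3) by blast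
    ultimately show ?thesis
      using isolated_arrow[OF K(1) e', of "fst f" "snd f" \<delta>] that(2) by simp
  qed
  have G': "arr \<alpha> = insert d (insert d' G)" using G_def d(1) d'(1) by blast
  have "arr (restrict_string \<alpha> (open_arc x y)) = arr \<gamma> \<or>
      arr (restrict_string \<alpha> (open_arc x y)) = insert d' (arr \<gamma>)"
    unfolding arr_restrict \<gamma>(1) G' using d(2) by (auto simp: open_arc_def)
  then have 1: "homotopic_strings \<gamma> (restrict_string \<alpha> (open_arc x y))"
    using one homotopic_eqI by (metis insertI1 insertI2)
  have "arr (restrict_string \<alpha> (open_arc x' y')) = arr \<gamma> \<or>
      arr (restrict_string \<alpha> (open_arc x' y')) = insert d (arr \<gamma>)"
    unfolding arr_restrict \<gamma>(2) G' using d'(2) by (auto simp: open_arc_def)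
  then have 2: "homotopic_strings \<gamma> (restrict_string \<alpha> (open_arc x' y'))"
    using one homotopic_eqI by (metis insertI1 insertI2)
  show ?thesis using 1 2 homotopic_sym homotopic_trans by blast
qed

text \<open>
  A move of type 3, seen from the distinguished arrow \<open>d\<close> that becomes \<open>d'\<close>. Its ends move along \<open>P\<close>
  and \<open>Q\<close>, and the other two arrows of the triangle join the third arc \<open>T\<close> to \<open>P\<close> and \<open>Q\<close>. Because a
  move of type 3 exchanges neighbouring ends, they use the points \<open>x'\<close>, \<open>y'\<close> before the move and \<open>x\<close>,
  \<open>y\<close> after it, and they also exchange \<open>k\<close> and \<open>k'\<close>. Up to this naming there are only two kinds of
  triangles: in the first one \<open>d\<close> is pushed off to one side, and of the other two arrows one points
  towards \<open>T\<close> and the other away from it; in the second one \<open>d\<close> is turned, and the other two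
  arrows both point towards \<open>T\<close> or both away from it.
\<close>

locale marked_triangle =
  fixes P Q T :: "complex set" and x x' y y' k k' :: complex
    and G :: "arrow set" and d d' e e' f f' :: arrow and \<alpha> \<beta> :: vstring
  assumes P: "arc_with_ends P x x'" and Q: "arc_with_ends Q y y'" and T: "arc_with_ends T k k'"
    and disj: "P \<inter> Q = {}" "P \<inter> T = {}" "Q \<inter> T = {}"
    and G: "is_virtual_string G" "ends G \<inter> P = {}" "ends G \<inter> Q = {}" "ends G \<inter> T = {}"
    and d: "d = (x, y) \<or> d = (y, x)" and d': "d' = (x', y') \<or> d' = (y', x')"
    and \<alpha>: "arr \<alpha> = G \<union> {d, e, f}" and \<beta>: "arr \<beta> = G \<union> {d', e', f'}"
    and cases: "(P = pos_arc x x' \<and> Q = pos_arc y' y \<or> P = pos_arc x' x \<and> Q = pos_arc y y') \<and>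
        ((e, f, e', f') = ((k', x'), (y', k), (k, x), (y, k')) \<or>
         (e, f, e', f') = ((x', k'), (k, y'), (x, k), (k', y)))
      \<or> (P = pos_arc x x' \<and> Q = pos_arc y y' \<or> P = pos_arc x' x \<and> Q = pos_arc y' y) \<and>
        ((e, f, e', f') = ((k', x'), (k, y'), (k, x), (k', y)) \<or>
         (e, f, e', f') = ((x', k'), (y', k), (x, k), (y, k')))"
begin

text \<open>
  If \<open>T\<close> lies on the other side, only stationary arrows are left. If \<open>T\<close> lies on the chosen side,
  then \<open>x'\<close> belongs to the old side exactly when \<open>x\<close> does not belong to the new one, and
  similarly for \<open>y'\<close> and \<open>y\<close>. If \<open>d\<close> is pushed off, the side contains both other arrows either
  before or after the move and neither of them at the other time; since one of them points towards \<open>T\<close>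
  and one away from it, they cancel. If \<open>d\<close> is turned, the side contains exactly one of them before
  and the other one after the move; they have the same direction, and one slides to the other.
\<close>

lemma homotopic_sides:
  "homotopic_strings (restrict_string \<alpha> (open_arc x y)) (restrict_string \<beta> (open_arc x' y'))"
proof -
  define X where "X = open_arc x y"
  define X' where "X' = open_arc x' y'"
  note c = arc_with_endsD[OF P] arc_with_endsD[OF Q] arc_with_endsD[OF T]
  have Gends: "ends G \<inter> (P \<union> Q) = {}" using G by blast
  note me = moved_ends[OF P Q disj(1)]
  obtain K \<gamma> where K: "is_arc K" "P \<union> Q \<subseteq> K" "K \<inter> (X \<inter> X') = {}"
    and \<gamma>: "arr \<gamma> = arrows_in G X" "arr \<gamma> = arrows_in G X'"
    and e: "endpoints \<gamma> \<inter> K = {}" "endpoints \<gamma> \<subseteq> ends G"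
    using common_side[OF P Q disj(1) G(1) Gends] unfolding X_def X'_def by blast
  have TX: "T \<subseteq> X \<or> T \<inter> X = {}" unfolding X_def
    using c disj me(1) by (intro arc_inside_or_outside[OF T]) auto
  have TX': "z \<in> X' \<longleftrightarrow> z \<in> X" if "z \<in> T" for z unfolding X_def X'_def
    using moved_open_arc[OF P Q disj(1), of z] that disj by blast
  have out: "x \<notin> X" "y \<notin> X" "x' \<notin> X'" "y' \<notin> X'" by (auto simp: X_def X'_def open_arc_def)
  have "homotopic_strings (restrict_string \<alpha> X) (restrict_string \<beta> X')"
  proof (cases "T \<subseteq> X")
    case False
    then have "T \<inter> X = {}" using TX by blast
    then have k: "k \<notin> X" "k' \<notin> X" "k \<notin> X'" "k' \<notin> X'" using TX' c by blast+
    have "arr (restrict_string \<alpha> X) = arr \<gamma>"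
      unfolding \<gamma>(1) arr_restrict \<alpha> using cases k out d by auto
    moreover have "arr (restrict_string \<beta> X') = arr \<gamma>"
      unfolding \<gamma>(2) arr_restrict \<beta> using cases k out d' by auto
    ultimately show ?thesis by (intro homotopic_eqI) simp
  next
    case True
    then have k: "k \<in> X" "k' \<in> X" "k \<in> X'" "k' \<in> X'" "T \<subseteq> X \<inter> X'" using TX' c by auto
    then have KT: "K \<inter> T = {}" using K(3) by blast
    then have TK: "T \<inter> K = {}" by blast
    have isT: "is_arc T" using T is_arc_def by blast
    have eT: "(K \<union> T) \<inter> endpoints \<gamma> = {}" using e G(4) by blast
    then have eT': "(T \<union> K) \<inter> endpoints \<gamma> = {}" by blast
    have inK: "x \<in> K" "x' \<in> K" "y \<in> K" "y' \<in> K" using c K(2) by auto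
    have pair: "homotopic_strings \<gamma> \<delta>"
      if "arr \<delta> = arr \<gamma> \<union> {(p, q), (q', p')}" "p \<in> T" "p' \<in> T" "p \<noteq> p'" "q \<in> K" "q' \<in> K" "q \<noteq> q'" for \<delta> p q p' q'
      using opposite_arrows[OF isT K(1) TK eT'] that by blast
    have A: "arr (restrict_string \<alpha> X) = arr \<gamma> \<union> arrows_in {e, f} X"
      unfolding \<gamma>(1) arr_restrict \<alpha> using out d by auto
    have B: "arr (restrict_string \<beta> X') = arr \<gamma> \<union> arrows_in {e', f'} X'"
      unfolding \<gamma>(2) arr_restrict \<beta> using out d' by auto
    from cases show ?thesis
    proof (elim disjE conjE)
      assume PQ: "P = pos_arc x x'" "Q = pos_arc y' y"
        and arrows: "(e, f, e', f') = ((k', x'), (y', k), (k, x), (y, k'))"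
      have "x' \<in> X" "y' \<in> X" "x \<notin> X'" "y \<notin> X'" using me(5,8) PQ X_def X'_def by auto
      then have "arr (restrict_string \<alpha> X) = arr \<gamma> \<union> {(k', x'), (y', k)}" "arr (restrict_string \<beta> X') = arr \<gamma>"
        unfolding A B using arrows k by auto
      then show ?thesis using pair[of "restrict_string \<alpha> X" k' x' y' k] c inK me homotopic_sym vstring_eqI by metis
    next
      assume PQ: "P = pos_arc x x'" "Q = pos_arc y' y"
        and arrows: "(e, f, e', f') = ((x', k'), (k, y'), (x, k), (k', y))"
      have "x' \<in> X" "y' \<in> X" "x \<notin> X'" "y \<notin> X'" using me(5,8) PQ X_def X'_def by auto
      then have "arr (restrict_string \<alpha> X) = arr \<gamma> \<union> {(k, y'), (x', k')}" "arr (restrict_string \<beta> X') = arr \<gamma>"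
        unfolding A B using arrows k by auto
      then show ?thesis using pair[of "restrict_string \<alpha> X" k y' x' k'] c inK me homotopic_sym vstring_eqI by metis
    next
      assume PQ: "P = pos_arc x' x" "Q = pos_arc y y'"
        and arrows: "(e, f, e', f') = ((k', x'), (y', k), (k, x), (y, k'))"
      have "x' \<notin> X" "y' \<notin> X" "x \<in> X'" "y \<in> X'" using me(6,7) PQ X_def X'_def by auto
      then have "arr (restrict_string \<beta> X') = arr \<gamma> \<union> {(k, x), (y, k')}" "arr (restrict_string \<alpha> X) = arr \<gamma>"
        unfolding A B using arrows k by auto
      then show ?thesis using pair[of "restrict_string \<beta> X'" k x y k'] c inK me vstring_eqI by metis
    next
      assume PQ: "P = pos_arc x' x" "Q = pos_arc y y'"
        and arrows: "(e, f, e', f') = ((x', k'), (k, y'), (x, k), (k', y))"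
      have "x' \<notin> X" "y' \<notin> X" "x \<in> X'" "y \<in> X'" using me(6,7) PQ X_def X'_def by auto
      then have "arr (restrict_string \<beta> X') = arr \<gamma> \<union> {(k', y), (x, k)}" "arr (restrict_string \<alpha> X) = arr \<gamma>"
        unfolding A B using arrows k by auto
      then show ?thesis using pair[of "restrict_string \<beta> X'" k' y x k] c inK me vstring_eqI by metis
    next
      assume PQ: "P = pos_arc x x'" "Q = pos_arc y y'"
        and arrows: "(e, f, e', f') = ((k', x'), (k, y'), (k, x), (k', y))"
      have "x' \<in> X" "y' \<notin> X" "x \<notin> X'" "y \<in> X'" using me(5,7) PQ X_def X'_def by auto
      then have "arr (restrict_string \<alpha> X) = insert (k', x') (arr \<gamma>)" "arr (restrict_string \<beta> X') = insert (k', y) (arr \<gamma>)"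
        unfolding A B using arrows k by auto
      then show ?thesis
        using slide_arrow[OF isT K(1) TK eT'[unfolded endpoints_eq_ends], of k' k' x' y] c inK by blast
    next
      assume PQ: "P = pos_arc x x'" "Q = pos_arc y y'"
        and arrows: "(e, f, e', f') = ((x', k'), (y', k), (x, k), (y, k'))"
      have "x' \<in> X" "y' \<notin> X" "x \<notin> X'" "y \<in> X'" using me(5,7) PQ X_def X'_def by auto
      then have "arr (restrict_string \<alpha> X) = insert (x', k') (arr \<gamma>)" "arr (restrict_string \<beta> X') = insert (y, k') (arr \<gamma>)"
        unfolding A B using arrows k by auto
      then show ?thesis
        using slide_arrow[OF K(1) isT KT eT[unfolded endpoints_eq_ends], of x' y k' k'] c inK by blast
    next
      assume PQ: "P = pos_arc x' x" "Q = pos_arc y' y"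
        and arrows: "(e, f, e', f') = ((k', x'), (k, y'), (k, x), (k', y))"
      have "x' \<notin> X" "y' \<in> X" "x \<in> X'" "y \<notin> X'" using me(6,8) PQ X_def X'_def by auto
      then have "arr (restrict_string \<alpha> X) = insert (k, y') (arr \<gamma>)" "arr (restrict_string \<beta> X') = insert (k, x) (arr \<gamma>)"
        unfolding A B using arrows k by auto
      then show ?thesis
        using slide_arrow[OF isT K(1) TK eT'[unfolded endpoints_eq_ends], of k k y' x] c inK by blast
    next
      assume PQ: "P = pos_arc x' x" "Q = pos_arc y' y"
        and arrows: "(e, f, e', f') = ((x', k'), (y', k), (x, k), (y, k'))"
      have "x' \<notin> X" "y' \<in> X" "x \<in> X'" "y \<notin> X'" using me(6,8) PQ X_def X'_def by auto
      then have "arr (restrict_string \<alpha> X) = insert (y', k) (arr \<gamma>)" "arr (restrict_string \<beta> X') = insert (x, k) (arr \<gamma>)"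
        unfolding A B using arrows k by auto
      then show ?thesis
        using slide_arrow[OF K(1) isT KT eT[unfolded endpoints_eq_ends], of y' x k k] c inK by blast
    qed
  qed
  then show ?thesis by (simp add: X_def X'_def)
qed

text \<open>
  Exchanging the roles of the two ends of the distinguished arrow gives the statements about its
  other side.
\<close>

lemma swapped: "marked_triangle Q P T y y' x x' k' k G d d' f f' e e' \<alpha> \<beta>"
proof (unfold_locales, goal_cases)
  case 3 show ?case using T arc_with_ends_sym by blast
next
  case 15 show ?case using cases by fast
qed (use P Q disj G d d' \<alpha> \<beta> in auto)

end

lemma type3_move_marked_triangle:
  assumes "type3_move \<alpha> R \<beta>" "(d, d') \<in> R"
  obtains P Q T x x' y y' k k' G e e' f f' where
    "marked_triangle P Q T x x' y y' k k' G d d' e e' f f' \<alpha> \<beta>" "d = (x, y)" "d' = (x', y')"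
proof -
  obtain G a a' b b' c c' where
    A: "arc_with_ends (pos_arc a a') a a'" "arc_with_ends (pos_arc b b') b b'" "arc_with_ends (pos_arc c c') c c'"
    and disj: "pos_arc a a' \<inter> pos_arc b b' = {}" "pos_arc b b' \<inter> pos_arc c c' = {}" "pos_arc c c' \<inter> pos_arc a a' = {}"
    and R: "R = {((a', b), (a, b')), ((b', c), (b, c')), ((c', a), (c, a'))} \<or>
        R = {((a, b), (a', b')), ((a', c), (a, c')), ((b', c'), (b, c))}"
    and arr: "arr \<alpha> = G \<union> fst ` R" "arr \<beta> = G \<union> snd ` R" and G: "is_virtual_string G"
    and Gends: "ends G \<inter> pos_arc a a' = {}" "ends G \<inter> pos_arc b b' = {}" "ends G \<inter> pos_arc c c' = {}"
    using type3_moveE[OF assms(1)] by metis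
  note A' = A[unfolded arc_with_ends_sym[of _ a a'] arc_with_ends_sym[of _ b b'] arc_with_ends_sym[of _ c c']]
  have disj': "pos_arc b b' \<inter> pos_arc a a' = {}" "pos_arc c c' \<inter> pos_arc b b' = {}" "pos_arc a a' \<inter> pos_arc c c' = {}"
    using disj by blast+
  note facts = A A' disj disj' G Gends
  from R show ?thesis
  proof
    assume R: "R = {((a', b), (a, b')), ((b', c), (b, c')), ((c', a), (c, a'))}"
    then consider "d = (a', b)" "d' = (a, b')" | "d = (b', c)" "d' = (b, c')" | "d = (c', a)" "d' = (c, a')"
      using assms(2) by auto
    then show ?thesis
    proof cases
      case 1
      have "marked_triangle (pos_arc a a') (pos_arc b b') (pos_arc c c') a' a b b' c c' G d d' (c', a) (c, a') (b', c) (b, c') \<alpha> \<beta>"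
        unfolding marked_triangle_def by (auto simp only: facts arr R 1 image_insert image_empty fst_conv snd_conv)
      then show ?thesis using that 1 by blast
    next
      case 2
      have "marked_triangle (pos_arc b b') (pos_arc c c') (pos_arc a a') b' b c c' a a' G d d' (a', b) (a, b') (c', a) (c, a') \<alpha> \<beta>"
        unfolding marked_triangle_def by (auto simp only: facts arr R 2 image_insert image_empty fst_conv snd_conv)
      then show ?thesis using that 2 by blast
    next
      case 3
      have "marked_triangle (pos_arc c c') (pos_arc a a') (pos_arc b b') c' c a a' b b' G d d' (b', c) (b, c') (a', b) (a, b') \<alpha> \<beta>"
        unfolding marked_triangle_def by (auto simp only: facts arr R 3 image_insert image_empty fst_conv snd_conv)
      then show ?thesis using that 3 by blast
    qed
  next
    assume R: "R = {((a, b), (a', b')), ((a', c), (a, c')), ((b', c'), (b, c))}"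
    then consider "d = (a, b)" "d' = (a', b')" | "d = (a', c)" "d' = (a, c')" | "d = (b', c')" "d' = (b, c)"
      using assms(2) by auto
    then show ?thesis
    proof cases
      case 1
      have "marked_triangle (pos_arc a a') (pos_arc b b') (pos_arc c c') a a' b b' c' c G d d' (a', c) (a, c') (b', c') (b, c) \<alpha> \<beta>"
        unfolding marked_triangle_def by (auto simp only: facts arr R 1 image_insert image_empty fst_conv snd_conv)
      then show ?thesis using that 1 by blast
    next
      case 2
      have "marked_triangle (pos_arc a a') (pos_arc c c') (pos_arc b b') a' a c c' b' b G d d' (a, b) (a', b') (b', c') (b, c) \<alpha> \<beta>"
        unfolding marked_triangle_def by (auto simp only: facts arr R 2 image_insert image_empty fst_conv snd_conv)
      then show ?thesis using that 2 by blast
    next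
      case 3
      have "marked_triangle (pos_arc b b') (pos_arc c c') (pos_arc a a') b' b c' c a' a G d d' (a, b) (a', b') (a', c) (a, c') \<alpha> \<beta>"
        unfolding marked_triangle_def by (auto simp only: facts arr R 3 image_insert image_empty fst_conv snd_conv)
      then show ?thesis using that 3 by blast
    qed
  qed
qed

section \<open>The two sides of the distinguished arrow\<close>

lemma homeo_inj_on_core: "orientation_preserving_homeo h \<Longrightarrow> inj_on h core"
  unfolding orientation_preserving_homeo_def homeomorphism_def by (metis inj_on_inverseI)

lemma homeo_open_arc:
  assumes "orientation_preserving_homeo h" "u \<in> core" "v \<in> core" "u \<noteq> v"
  shows "h ` open_arc u v = open_arc (h u) (h v)"
proof -
  have "h ` (pos_arc u v - {u, v}) = h ` pos_arc u v - h ` {u, v}"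
    using homeo_inj_on_core[OF assms(1)] pos_arc_subset_core assms(2,3)
    by (intro inj_on_image_set_diff[of h core]) auto
  moreover have "h ` pos_arc u v = pos_arc (h u) (h v)"
    using assms unfolding orientation_preserving_homeo_def by blast
  ultimately show ?thesis unfolding open_arc_def by simp
qed

lemma homeo_mem_open_arc:
  assumes "orientation_preserving_homeo h" "u \<in> core" "v \<in> core" "u \<noteq> v" "z \<in> core"
  shows "h z \<in> open_arc (h u) (h v) \<longleftrightarrow> z \<in> open_arc u v"
  unfolding homeo_open_arc[OF assms(1-4), symmetric]
  using homeo_inj_on_core[OF assms(1)] assms(5) open_arc_subset_core by (meson inj_on_image_mem_iff)

lemma homeo_move_sides:
  assumes "homeo_move h \<alpha> \<beta>" "u \<in> core" "v \<in> core" "u \<noteq> v"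
  shows "homotopic_strings (restrict_string \<alpha> (open_arc u v)) (restrict_string \<beta> (open_arc (h u) (h v)))"
  using assms(1)
proof cases
  case 1
  have e: "fst e \<in> core" "snd e \<in> core" if "e \<in> arr \<alpha>" for e
    using arrow_ends that by blast+
  have "arr (restrict_string \<beta> (open_arc (h u) (h v))) = map_prod h h ` arr (restrict_string \<alpha> (open_arc u v))"
    unfolding arr_restrict 1(2) using e homeo_mem_open_arc[OF 1(1) assms(2-4)] by force
  then have "homeo_move h (restrict_string \<alpha> (open_arc u v)) (restrict_string \<beta> (open_arc (h u) (h v)))"
    using 1(1) homeo_move.intros by blast
  then show ?thesis using move_imp_homotopic move_def by blast
qed

text \<open>
  The order of the two sides depends on the sign because a singular move of type 2 replaces the
  distinguished arrow by an oppositely directed one, which exchanges the two sides, and reverses the sign.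
\<close>

definition sides :: "sstring \<Rightarrow> vclass \<times> vclass" where
  "sides = (\<lambda>(\<alpha>, d, \<epsilon>). case \<epsilon> of
     Pos \<Rightarrow> (vclass_of (side1 \<alpha> d), vclass_of (side2 \<alpha> d))
   | Neg \<Rightarrow> (vclass_of (side2 \<alpha> d), vclass_of (side1 \<alpha> d)))"

lemma sides_eqI:
  assumes "homotopic_strings (side1 \<alpha> d) (side1 \<beta> d')" "homotopic_strings (side2 \<alpha> d) (side2 \<beta> d')"
  shows "sides (\<alpha>, d, \<epsilon>) = sides (\<beta>, d', \<epsilon>)"
  using assms by (cases \<epsilon>) (simp_all add: sides_def vclass.abs_eq_iff)

lemma smove_sides:
  assumes "smove s t" shows "sides s = sides t"
  using assms
proof cases
  case (homeo d \<alpha> h \<beta> \<epsilon>)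
  then show ?thesis unfolding homeo(1,2)
    using arrow_ends[OF homeo(3)]
    by (intro sides_eqI) (auto simp: side1_def side2_def intro: homeo_move_sides)
next
  case (regular1 d \<alpha> \<beta> \<epsilon>)
  then show ?thesis unfolding regular1(1,2)
    using arrow_ends[OF regular1(3)]
    by (intro sides_eqI) (auto simp: side1_def side2_def intro!: type1_move_sides)
next
  case (regular2 d \<alpha> \<beta> \<epsilon>)
  then show ?thesis unfolding regular2(1,2)
    using arrow_ends[OF regular2(3)]
    by (intro sides_eqI) (auto simp: side1_def side2_def intro!: type2_move_sides)
next
  case (regular3 d \<alpha> R \<beta> \<epsilon>)
  then show ?thesis unfolding regular3(1,2)
    using arrow_ends[OF regular3(3)]
    by (intro sides_eqI) (auto simp: side1_def side2_def intro!: type3_move_sides[OF regular3(4,3,5)])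
next
  case (singular2 I a a' J b b' \<alpha> d d' \<epsilon>)
  have JI: "J \<inter> I = {}" using singular2(5) by blast
  have "homotopic_strings (restrict_string \<alpha> (open_arc a b)) (restrict_string \<alpha> (open_arc a' b'))"
    using singular2 by (intro parallel_arrows_sides[OF singular2(3,4,5), where d = "(a, b)" and d' = "(b', a')"]) auto
  moreover have "homotopic_strings (restrict_string \<alpha> (open_arc b a)) (restrict_string \<alpha> (open_arc b' a'))"
    using singular2 by (intro parallel_arrows_sides[OF singular2(4,3) JI, where d = "(a, b)" and d' = "(b', a')"]) auto
  moreover note homotopic_sym[OF calculation(1)] homotopic_sym[OF calculation(2)]
  ultimately show ?thesis unfolding singular2(1,2)
    using singular2(10) by (cases \<epsilon>) (auto simp: sides_def side1_def side2_def vclass.abs_eq_iff)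
next
  case (singular3 \<alpha> R \<beta> d d' \<epsilon>)
  obtain P Q T x x' y y' k k' G e e' f f' where
    M: "marked_triangle P Q T x x' y y' k k' G d d' e e' f f' \<alpha> \<beta>" and d: "d = (x, y)" "d' = (x', y')"
    using type3_move_marked_triangle[OF singular3(3,4)] by metis
  show ?thesis unfolding singular3(1,2)
    using marked_triangle.homotopic_sides[OF M] marked_triangle.homotopic_sides[OF marked_triangle.swapped[OF M]]
    by (intro sides_eqI) (auto simp: side1_def side2_def d)
qed

section \<open>The signed index\<close>

text \<open>
  The number of arrows of \<open>A\<close> that leave \<open>X\<close> minus the number of those that enter it. In this
  form it is additive in the ends of the arrows, and arrows with both ends in \<open>X\<close> cancel
  automatically.
\<close>

definition flow :: "complex set \<Rightarrow> arrow set \<Rightarrow> int" where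
  "flow X A = (\<Sum>g\<in>A. of_bool (fst g \<in> X) - of_bool (snd g \<in> X))"

lemma flow_union:
  "finite A \<Longrightarrow> finite B \<Longrightarrow> A \<inter> B = {} \<Longrightarrow> flow X (A \<union> B) = flow X A + flow X B"
  unfolding flow_def by (rule sum.union_disjoint)

lemma flow_insert [simp]:
  "finite A \<Longrightarrow> (a, b) \<notin> A \<Longrightarrow> flow X (insert (a, b) A) = of_bool (a \<in> X) - of_bool (b \<in> X) + flow X A"
  unfolding flow_def by simp

lemma flow_empty [simp]: "flow X {} = 0"
  unfolding flow_def by simp

lemma flow_cong:
  assumes "\<And>z. z \<in> ends A \<Longrightarrow> z \<in> X \<longleftrightarrow> z \<in> Y" shows "flow X A = flow Y A"
  unfolding flow_def using assms by (intro sum.cong) (auto simp: ends_def)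

lemma flow_complement:
  assumes "\<And>z. z \<in> ends A \<Longrightarrow> z \<in> X \<longleftrightarrow> z \<notin> Y" shows "flow X A = - flow Y A"
  unfolding flow_def sum_negf[symmetric]
  by (rule sum.cong) (use assms in \<open>auto simp: ends_def\<close>)

lemma finite_arr [simp]: "finite (arr \<alpha>)"
  using is_virtual_string_arr by (simp add: is_virtual_string_def)

lemma flow_homeo:
  assumes "orientation_preserving_homeo h" "A \<subseteq> core \<times> core" "u \<in> core" "v \<in> core" "u \<noteq> v"
  shows "flow (open_arc (h u) (h v)) (map_prod h h ` A) = flow (open_arc u v) A"
proof -
  have "inj_on (map_prod h h) A"
    using map_prod_inj_on[OF homeo_inj_on_core[OF assms(1)] homeo_inj_on_core[OF assms(1)]] assms(2)
    by (rule inj_on_subset)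
  then have "flow (open_arc (h u) (h v)) (map_prod h h ` A) =
      (\<Sum>g\<in>A. of_bool (h (fst g) \<in> open_arc (h u) (h v)) - of_bool (h (snd g) \<in> open_arc (h u) (h v)))"
    unfolding flow_def by (simp add: sum.reindex)
  also have "\<dots> = flow (open_arc u v) A"
    unfolding flow_def using homeo_mem_open_arc[OF assms(1,3-5)] assms(2) by (intro sum.cong) auto
  finally show ?thesis .
qed

text \<open>
  This is, up to sign, Turaev's index of an arrow, from which the \<open>u\<close>-polynomial is formed. The arrow \<open>d\<close>
  itself contributes 0, because an open arc does not contain its ends.
\<close>

definition crossing_index :: "vstring \<Rightarrow> arrow \<Rightarrow> int" where
  "crossing_index \<alpha> d = flow (open_arc (fst d) (snd d)) (arr \<alpha>)"

definition signed_index :: "sstring \<Rightarrow> int" where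
  "signed_index = (\<lambda>(\<alpha>, d, \<epsilon>). case \<epsilon> of Pos \<Rightarrow> crossing_index \<alpha> d | Neg \<Rightarrow> - crossing_index \<alpha> d)"

lemma type1_move_crossing_index:
  assumes "type1_move \<alpha> \<beta>" "d \<in> arr \<alpha>"
  shows "crossing_index \<beta> d = crossing_index \<alpha> d"
  using assms(1)
proof cases
  case (1 a b)
  have I: "arc_with_ends (pos_arc a b) a b" using 1 by (auto simp: arc_with_ends_def)
  note ab = arc_with_endsD(4,5)[OF I]
  define X where "X = open_arc (fst d) (snd d)"
  have "pos_arc a b \<subseteq> X \<or> pos_arc a b \<inter> X = {}"
    unfolding X_def using 1(4) arrow_ends[OF assms(2)]
    by (intro arc_inside_or_outside[OF I]) auto
  then have X: "a \<in> X \<longleftrightarrow> b \<in> X" using ab by blast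
  have "a \<notin> endpoints \<alpha>" "b \<notin> endpoints \<alpha>" using ab 1(4) by blast+
  then have "(a, b) \<notin> arr \<alpha>" "(b, a) \<notin> arr \<alpha>" using arrow_ends by force+
  then show ?thesis unfolding crossing_index_def X_def[symmetric] using 1(5) X by auto
qed

lemma type2_move_crossing_index:
  assumes "type2_move \<alpha> \<beta>" "d \<in> arr \<alpha>"
  shows "crossing_index \<beta> d = crossing_index \<alpha> d"
  using assms(1)
proof cases
  case (1 I a a' J b b')
  note ab = arc_with_endsD(3-5)[OF 1(1)] arc_with_endsD(3-5)[OF 1(2)]
  define X where "X = open_arc (fst d) (snd d)"
  have "I \<subseteq> X \<or> I \<inter> X = {}"
    unfolding X_def using 1(4) arrow_ends[OF assms(2)]
    by (intro arc_inside_or_outside[OF 1(1)]) auto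
  moreover have "J \<subseteq> X \<or> J \<inter> X = {}"
    unfolding X_def using 1(5) arrow_ends[OF assms(2)]
    by (intro arc_inside_or_outside[OF 1(2)]) auto
  ultimately have X: "a \<in> X \<longleftrightarrow> a' \<in> X" "b \<in> X \<longleftrightarrow> b' \<in> X" using ab by blast+
  have "a \<notin> endpoints \<alpha>" "b' \<notin> endpoints \<alpha>" using ab 1(4,5) by blast+
  then have "(a, b) \<notin> arr \<alpha>" "(b', a') \<notin> arr \<alpha>" using arrow_ends(1) by force+
  moreover have "(a, b) \<noteq> (b', a')" using ab 1(3) by auto
  moreover have "arr \<beta> = insert (a, b) (insert (b', a') (arr \<alpha>))" using 1(6) by blast
  ultimately show ?thesis unfolding crossing_index_def X_def[symmetric] using X by simp
qed

text \<open>
  The three arrows of a triangle are distinct from each other and from the stationary arrows, and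
  so are the three arrows that replace them. Hence a sum over a string can be compared term by term with the
  corresponding sum after the move.
\<close>

lemma type3_move_sum:
  fixes F :: "arrow \<Rightarrow> 'a::comm_monoid_add"
  assumes R: "type3_move \<alpha> R \<beta>"
  shows "sum F (arr \<alpha>) = sum F (arr \<alpha> - fst ` R) + (\<Sum>r\<in>R. F (fst r))"
    and "sum F (arr \<beta>) = sum F (arr \<alpha> - fst ` R) + (\<Sum>r\<in>R. F (snd r))"
proof -
  obtain G a a' b b' c c' where
    A: "arc_with_ends (pos_arc a a') a a'" "arc_with_ends (pos_arc b b') b b'" "arc_with_ends (pos_arc c c') c c'"
    and disj: "pos_arc a a' \<inter> pos_arc b b' = {}" "pos_arc b b' \<inter> pos_arc c c' = {}" "pos_arc c c' \<inter> pos_arc a a' = {}"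
    and Rcases: "R = {((a', b), (a, b')), ((b', c), (b, c')), ((c', a), (c, a'))} \<or>
        R = {((a, b), (a', b')), ((a', c), (a, c')), ((b', c'), (b, c))}"
    and G: "G = arr \<alpha> - fst ` R"
    and arr: "arr \<alpha> = G \<union> fst ` R" "arr \<beta> = G \<union> snd ` R"
    and Gends: "ends G \<inter> pos_arc a a' = {}" "ends G \<inter> pos_arc b b' = {}" "ends G \<inter> pos_arc c c' = {}"
    using type3_moveE[OF R] by metis
  note mem = arc_with_endsD(3-5)[OF A(1)] arc_with_endsD(3-5)[OF A(2)] arc_with_endsD(3-5)[OF A(3)]
  have "a \<noteq> b" "a \<noteq> b'" "a' \<noteq> b" "a' \<noteq> b'" "a \<noteq> c" "a \<noteq> c'" "a' \<noteq> c" "a' \<noteq> c'"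
    "b \<noteq> c" "b \<noteq> c'" "b' \<noteq> c" "b' \<noteq> c'"
    using mem disj by blast+
  then have inj: "inj_on fst R" "inj_on snd R"
    using Rcases mem(1,4,7) by (auto simp: inj_on_def)
  have "z \<notin> ends G" if "z \<in> {a, a', b, b', c, c'}" for z using that mem Gends by blast
  moreover have "p \<in> ends G" if "(p, q) \<in> G" for p q using that by (force simp: ends_def)
  ultimately have "(p, q) \<notin> G" if "p \<in> {a, a', b, b', c, c'}" for p q using that by blast
  then have dj: "G \<inter> fst ` R = {}" "G \<inter> snd ` R = {}" using Rcases by auto
  have fin: "finite G" "finite (fst ` R)" "finite (snd ` R)"
    using Rcases G by auto
  show "sum F (arr \<alpha>) = sum F (arr \<alpha> - fst ` R) + (\<Sum>r\<in>R. F (fst r))"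
    unfolding G[symmetric] unfolding arr sum.union_disjoint[OF fin(1,2) dj(1)] by (simp add: sum.reindex[OF inj(1)])
  show "sum F (arr \<beta>) = sum F (arr \<alpha> - fst ` R) + (\<Sum>r\<in>R. F (snd r))"
    unfolding G[symmetric] unfolding arr sum.union_disjoint[OF fin(1,3) dj(2)] by (simp add: sum.reindex[OF inj(2)])
qed

lemma type3_move_crossing_index:
  assumes R: "type3_move \<alpha> R \<beta>" and d: "d \<in> arr \<alpha>" "d \<notin> fst ` R"
  shows "crossing_index \<beta> d = crossing_index \<alpha> d"
proof -
  define X where "X = open_arc (fst d) (snd d)"
  obtain G a a' b b' c c' where
    A: "arc_with_ends (pos_arc a a') a a'" "arc_with_ends (pos_arc b b') b b'" "arc_with_ends (pos_arc c c') c c'"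
    and Rcases: "R = {((a', b), (a, b')), ((b', c), (b, c')), ((c', a), (c, a'))} \<or>
        R = {((a, b), (a', b')), ((a', c), (a, c')), ((b', c'), (b, c))}"
    and G: "G = arr \<alpha> - fst ` R"
    and Gends: "ends G \<inter> pos_arc a a' = {}" "ends G \<inter> pos_arc b b' = {}" "ends G \<inter> pos_arc c c' = {}"
    using type3_moveE[OF R] by metis
  note mem = arc_with_endsD(4,5)[OF A(1)] arc_with_endsD(4,5)[OF A(2)] arc_with_endsD(4,5)[OF A(3)]
  have "{fst d, snd d} \<subseteq> ends G" using d G by (auto simp: ends_def)
  then have "I \<subseteq> X \<or> I \<inter> X = {}" if "arc_with_ends I p q" "ends G \<inter> I = {}" for I p q
    unfolding X_def using that arrow_ends[OF d(1)] by (intro arc_inside_or_outside) auto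
  then have "a' \<in> X \<longleftrightarrow> a \<in> X" "b' \<in> X \<longleftrightarrow> b \<in> X" "c' \<in> X \<longleftrightarrow> c \<in> X"
    using A Gends mem by blast+
  then have "(\<Sum>r\<in>R. of_bool (fst (fst r) \<in> X) - of_bool (snd (fst r) \<in> X) :: int) =
      (\<Sum>r\<in>R. of_bool (fst (snd r) \<in> X) - of_bool (snd (snd r) \<in> X))"
    using Rcases by (intro sum.cong) auto
  then show ?thesis
    unfolding crossing_index_def X_def[symmetric] flow_def type3_move_sum[OF R] by simp
qed

text \<open>
  Passing to the opposite arrow turns the arc \<open>X\<close> into an arc \<open>Y\<close> that is complementary to it
  near all stationary ends, so their contribution changes its sign; the contributions of the two
  arrows to the index of each other are compared separately.
\<close>

lemma parallel_arrows_crossing_index: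
  assumes P: "arc_with_ends P x x'" and Q: "arc_with_ends Q y y'" and disj: "P \<inter> Q = {}"
    and int: "(P - {x, x'}) \<inter> endpoints \<alpha> = {}" "(Q - {y, y'}) \<inter> endpoints \<alpha> = {}"
    and d: "(x, y) \<in> arr \<alpha>" "(y', x') \<in> arr \<alpha>"
  shows "crossing_index \<alpha> (y', x') = - crossing_index \<alpha> (x, y)"
proof -
  define X where "X = open_arc x y"
  define Y where "Y = open_arc y' x'"
  define G where "G = arr \<alpha> - {(x, y), (y', x')}"
  note c = arc_with_endsD[OF P] arc_with_endsD[OF Q]
  note me = moved_ends[OF P Q disj]
  have "ends G \<inter> ends {(x, y), (y', x')} = {}"
  proof -
    have "{fst e, snd e} \<inter> {fst f, snd f} = {}" if "e \<in> G" "f \<in> {(x, y), (y', x')}" for e f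
      using that d is_virtual_string_arr[of \<alpha>] unfolding G_def is_virtual_string_def by blast
    then show ?thesis unfolding ends_def by blast
  qed
  moreover have "ends G \<subseteq> endpoints \<alpha>" unfolding endpoints_eq_ends G_def by (intro ends_mono) blast
  moreover have "ends {(x, y), (y', x')} = {x, x', y, y'}" by auto
  ultimately have Gends: "ends G \<inter> (P \<union> Q) = {}" "ends G \<subseteq> core"
    using int endpoints_subset_core[of \<alpha>] by blast+
  have "z \<in> X \<longleftrightarrow> z \<notin> Y" if z: "z \<in> ends G" for z
  proof -
    have "z \<notin> P" "z \<notin> Q" "z \<in> core" using z Gends by auto
    then show ?thesis unfolding X_def Y_def
      using moved_open_arc[OF P Q disj, of z] core_split[of x' y' z] c me(2) by metis
  qed
  \<comment> \<open>The stationary arrows change the sign of their contribution; the rest of the proof treats the two arrows themselves.\<close>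
  then have 1: "flow X G = - flow Y G" by (rule flow_complement)
  have arr: "arr \<alpha> = insert (x, y) (insert (y', x') G)" using d G_def by blast
  have fG: "finite G" "(x, y) \<notin> G" "(y', x') \<notin> G" "x \<noteq> y'" using me by (auto simp: G_def)
  have out: "x \<notin> X" "y \<notin> X" "x' \<notin> Y" "y' \<notin> Y" by (auto simp: X_def Y_def open_arc_def)
  have "y \<in> Y \<longleftrightarrow> y \<notin> open_arc x' y'" "x \<in> Y \<longleftrightarrow> x \<notin> open_arc x' y'"
    unfolding Y_def using core_split[of x' y' y] core_split[of x' y' x] c me(1-4) by metis+
  then have "(x' \<in> X \<longleftrightarrow> x \<in> Y) \<and> (y' \<in> X \<longleftrightarrow> y \<in> Y)"
    using me(5-8) P Q unfolding arc_with_ends_def X_def by blast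
  then show ?thesis unfolding crossing_index_def fst_conv snd_conv X_def[symmetric] Y_def[symmetric] arr
    using 1 fG out by simp
qed

text \<open>
  In a triangle that is pushed off, the two other arrows cross \<open>d\<close> in opposite directions or do
  not cross it. In one that is turned, if \<open>T\<close> lies in \<open>X\<close>, exactly one of the two arrows crosses it before the
  move and the other one does so after it, in the same direction; likewise if \<open>T\<close> lies outside.
\<close>

lemma (in marked_triangle) flow_invariant:
  "flow (open_arc x y) (arr \<alpha>) = flow (open_arc x' y') (arr \<beta>)"
proof -
  define X where "X = open_arc x y"
  define X' where "X' = open_arc x' y'"
  note c = arc_with_endsD[OF P] arc_with_endsD[OF Q] arc_with_endsD[OF T]
  note me = moved_ends[OF P Q disj(1)]
  have out: "x \<notin> X" "y \<notin> X" "x' \<notin> X'" "y' \<notin> X'" by (auto simp: X_def X'_def open_arc_def)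
  have TX: "T \<subseteq> X \<or> T \<inter> X = {}" unfolding X_def
    using c disj me(1) by (intro arc_inside_or_outside[OF T]) auto
  have TX': "z \<in> X' \<longleftrightarrow> z \<in> X" if "z \<in> T" for z unfolding X_def X'_def
    using moved_open_arc[OF P Q disj(1), of z] that disj by blast
  have k: "k' \<in> X \<longleftrightarrow> k \<in> X" "k \<in> X' \<longleftrightarrow> k \<in> X" "k' \<in> X' \<longleftrightarrow> k \<in> X" using TX TX' c by blast+
  have "flow X G = flow X' G"
    using moved_open_arc[OF P Q disj(1)] G unfolding X_def X'_def by (intro flow_cong) blast
  moreover have "finite G" using G(1) by (simp add: is_virtual_string_def)
  moreover have "G \<inter> {d, e, f} = {}" "G \<inter> {d', e', f'} = {}"
  proof -
    have "z \<notin> ends G" if "z \<in> {x, x', y, y', k, k'}" for z using that c G by blast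
    moreover have "p \<in> ends G" if "(p, q) \<in> G" for p q using that by (force simp: ends_def)
    ultimately have "(p, q) \<notin> G" if "p \<in> {x, x', y, y', k, k'}" for p q using that by blast
    then show "G \<inter> {d, e, f} = {}" "G \<inter> {d', e', f'} = {}" using d d' cases by auto
  qed
  moreover have "flow X {d, e, f} = flow X' {d', e', f'}"
  proof -
    have "x \<noteq> k" "x \<noteq> k'" "x' \<noteq> k" "x' \<noteq> k'" "y \<noteq> k" "y \<noteq> k'" "y' \<noteq> k" "y' \<noteq> k'"
      using c disj by blast+
    note ne = this this[symmetric] me(1-4) me(1-4)[symmetric] c(3,9,15) c(3,9,15)[symmetric]
    from cases show ?thesis
      by (elim disjE conjE) (use me(5-8) d d' out ne k in \<open>auto simp: X_def[symmetric] X'_def[symmetric]\<close>)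
  qed
  ultimately have "flow X (G \<union> {d, e, f}) = flow X' (G \<union> {d', e', f'})"
    by (simp add: flow_union del: flow_insert Un_insert_right)
  then show ?thesis unfolding \<alpha> \<beta> X_def X'_def .
qed

lemma smove_signed_index:
  assumes "smove s t" shows "signed_index s = signed_index t"
  using assms
proof cases
  case (homeo d \<alpha> h \<beta> \<epsilon>)
  have "arr \<alpha> \<subseteq> core \<times> core" using is_virtual_string_arr by (simp add: is_virtual_string_def)
  moreover have "orientation_preserving_homeo h" "arr \<beta> = map_prod h h ` arr \<alpha>"
    using homeo(4) by (auto elim: homeo_move.cases)
  ultimately have "crossing_index \<beta> (map_prod h h d) = crossing_index \<alpha> d"
    unfolding crossing_index_def using flow_homeo arrow_ends[OF homeo(3)] by simp
  then show ?thesis unfolding homeo(1,2) by (cases \<epsilon>) (simp_all add: signed_index_def)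
next
  case (regular1 d \<alpha> \<beta> \<epsilon>)
  then show ?thesis using type1_move_crossing_index by (cases \<epsilon>) (simp_all add: signed_index_def)
next
  case (regular2 d \<alpha> \<beta> \<epsilon>)
  then show ?thesis using type2_move_crossing_index by (cases \<epsilon>) (simp_all add: signed_index_def)
next
  case (regular3 d \<alpha> R \<beta> \<epsilon>)
  then show ?thesis using type3_move_crossing_index by (cases \<epsilon>) (simp_all add: signed_index_def)
next
  case (singular2 I a a' J b b' \<alpha> d d' \<epsilon>)
  have "crossing_index \<alpha> (b', a') = - crossing_index \<alpha> (a, b)"
    using parallel_arrows_crossing_index singular2(3-9) by blast
  then show ?thesis unfolding singular2(1,2)
    using singular2(10) by (cases \<epsilon>) (auto simp: signed_index_def)
next
  case (singular3 \<alpha> R \<beta> d d' \<epsilon>)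
  obtain P Q T x x' y y' k k' G e e' f f' where
    M: "marked_triangle P Q T x x' y y' k k' G d d' e e' f f' \<alpha> \<beta>" and d: "d = (x, y)" "d' = (x', y')"
    using type3_move_marked_triangle[OF singular3(3,4)] by metis
  show ?thesis unfolding singular3(1,2)
    using marked_triangle.flow_invariant[OF M] by (cases \<epsilon>) (simp_all add: signed_index_def crossing_index_def d)
qed

section \<open>Passing to homotopy classes\<close>

lemma smove_is_signed_singular:
  assumes "smove s t" shows "is_signed_singular s \<and> is_signed_singular t"
  using assms
proof cases
  case (homeo d \<alpha> h \<beta> \<epsilon>)
  then show ?thesis by (auto simp: is_signed_singular_def elim: homeo_move.cases)
next
  case (regular1 d \<alpha> \<beta> \<epsilon>)
  then show ?thesis by (auto simp: is_signed_singular_def elim: type1_move.cases)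
next
  case (regular2 d \<alpha> \<beta> \<epsilon>)
  then show ?thesis by (auto simp: is_signed_singular_def elim: type2_move.cases)
next
  case (regular3 d \<alpha> R \<beta> \<epsilon>)
  then show ?thesis by (auto simp: is_signed_singular_def elim: type3_move.cases)
next
  case (singular2 I a a' J b b' \<alpha> d d' \<epsilon>)
  then show ?thesis by (auto simp: is_signed_singular_def)
next
  case (singular3 \<alpha> R \<beta> d d' \<epsilon>)
  have "d \<in> fst ` R" "d' \<in> snd ` R" using singular3(4) by force+
  then have "d \<in> arr \<alpha>" "d' \<in> arr \<beta>"
    using singular3(3) by (auto elim!: type3_move.cases)
  then show ?thesis unfolding singular3(1,2) by (simp add: is_signed_singular_def)
qed

lemma sclass_of_eq_iff:
  assumes "is_signed_singular s" "is_signed_singular t"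
  shows "sclass_of s = sclass_of t \<longleftrightarrow> equivclp smove s t"
  using Quotient3_rel[OF Quotient3_sclass, of s t] assms
  by (auto simp: homotopic_singular_def)

lemma smove_sclass_of:
  assumes "smove s t" shows "sclass_of s = sclass_of t"
  using sclass_of_eq_iff smove_is_signed_singular[OF assms] r_into_equivclp[of smove, OF assms] by blast

lemma equivclp_invariant:
  assumes "equivclp r s t" and "\<And>s t. r s t \<Longrightarrow> f s = f t"
  shows "f s = f t"
  using assms(1)
proof (induction rule: equivclp_induct)
  case (step t u)
  then show ?case using assms(2)[of t u] assms(2)[of u t] by auto
qed simp

text \<open>
  Representatives are chosen by the quotient construction; an invariant of the moves takes the
  same value on the chosen representative of a class as on any other one.
\<close>

lemma rep_sclass_invariant:
  assumes "\<And>s t. smove s t \<Longrightarrow> f s = f t" and s: "is_signed_singular s"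
  shows "f (rep_sclass (sclass_of s)) = f s"
proof -
  have "homotopic_singular s s" using s by (simp add: homotopic_singular_def)
  then have "homotopic_singular (rep_sclass (sclass_of s)) s"
    by (rule rep_abs_rsp_left[OF Quotient3_sclass])
  then have "equivclp smove (rep_sclass (sclass_of s)) s" by (simp add: homotopic_singular_def)
  then show ?thesis using equivclp_invariant assms(1) by metis
qed

lemma semi_trivial_is_signed_singular: "semi_trivial_string s \<Longrightarrow> is_signed_singular s"
  by (auto simp: semi_trivial_string_def is_signed_singular_def)

lemma sgen_semi_trivial: "semi_trivial_string s \<Longrightarrow> sgen (sclass_of s) = 0"
  unfolding sgen_def semi_trivial_class_def by (rule if_P) blast

section \<open>Homotopy invariance of \<open>\<mu>\<close>\<close>

lemma homeo_move_mu:
  assumes "homeo_move h \<alpha> \<beta>" shows "mu_string \<beta> = mu_string \<alpha>"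
  using assms
proof cases
  case 1
  have "arr \<alpha> \<subseteq> core \<times> core" using is_virtual_string_arr by (simp add: is_virtual_string_def)
  then have "inj_on (map_prod h h) (arr \<alpha>)"
    using map_prod_inj_on[OF homeo_inj_on_core[OF 1(1)] homeo_inj_on_core[OF 1(1)]] by (metis inj_on_subset)
  moreover have "sclass_of (\<beta>, map_prod h h d, \<epsilon>) = sclass_of (\<alpha>, d, \<epsilon>)" if "d \<in> arr \<alpha>" for d \<epsilon>
    using smove_sclass_of[OF smove.homeo[OF that assms]] by simp
  ultimately show ?thesis
    unfolding mu_string_def 1(2) by (simp add: sum.reindex cong: sum.cong)
qed

text \<open>
  The new arrow gives semi-trivial classes, and the moves of the other singular strings are regular.
\<close>

lemma type1_move_mu:
  assumes "type1_move \<alpha> \<beta>" shows "mu_string \<beta> = mu_string \<alpha>"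
  using assms
proof cases
  case (1 a b)
  obtain e where e: "e \<in> {(a, b), (b, a)}" "arr \<beta> = insert e (arr \<alpha>)" using 1(5) by blast
  have "a \<in> pos_arc a b" using ends_mem_pos_arc 1 by blast
  then have "a \<notin> endpoints \<alpha>" using 1(4) by blast
  then have new: "e \<notin> arr \<alpha>" using e(1) arrow_ends[of e \<alpha>] by auto
  have "endpoints \<beta> = endpoints \<alpha> \<union> {a, b}" unfolding endpoints_eq_ends e(2) using e(1) by auto
  then have "open_arc a b \<inter> endpoints \<beta> = {}" using 1(4) unfolding open_arc_def by blast
  then have "semi_trivial_string (\<beta>, e, \<epsilon>)" for \<epsilon>
    using e unfolding semi_trivial_string_def by auto
  then have "sgen (sclass_of (\<beta>, e, \<epsilon>)) = 0" for \<epsilon> by (rule sgen_semi_trivial)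
  moreover have "sclass_of (\<beta>, d, \<epsilon>) = sclass_of (\<alpha>, d, \<epsilon>)" if "d \<in> arr \<alpha>" for d \<epsilon>
    using smove_sclass_of[OF smove.regular1[OF that assms]] by simp
  ultimately show ?thesis
    unfolding mu_string_def e(2) using new by (simp cong: sum.cong)
qed

text \<open>
  The two new arrows are exchanged, with a change of sign, by a singular move of type 2, so their
  four contributions cancel.
\<close>

lemma type2_move_mu:
  assumes "type2_move \<alpha> \<beta>" shows "mu_string \<beta> = mu_string \<alpha>"
  using assms
proof cases
  case (1 I a a' J b b')
  note c = arc_with_endsD[OF 1(1)] arc_with_endsD[OF 1(2)]
  have arr: "arr \<beta> = insert (a, b) (insert (b', a') (arr \<alpha>))" using 1(6) by blast
  have "a \<notin> endpoints \<alpha>" "b' \<notin> endpoints \<alpha>" using c 1(4,5) by blast+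
  then have new: "(a, b) \<notin> arr \<alpha>" "(b', a') \<notin> arr \<alpha>" "(a, b) \<noteq> (b', a')"
    using arrow_ends(1) c 1(3) by force+
  have "endpoints \<beta> = endpoints \<alpha> \<union> {a, b, a', b'}" unfolding endpoints_eq_ends arr by auto
  then have int: "(I - {a, a'}) \<inter> endpoints \<beta> = {}" "(J - {b, b'}) \<inter> endpoints \<beta> = {}"
    using 1(3-5) c by blast+
  have "smove (\<beta>, (a, b), \<epsilon>) (\<beta>, (b', a'), opposite \<epsilon>)" for \<epsilon>
    using arr by (intro smove.singular2[OF 1(1-3) int]) auto
  then have "sclass_of (\<beta>, (b', a'), opposite \<epsilon>) = sclass_of (\<beta>, (a, b), \<epsilon>)" for \<epsilon>
    using smove_sclass_of by metis
  from this[of Pos] this[of Neg] have "sclass_of (\<beta>, (b', a'), Neg) = sclass_of (\<beta>, (a, b), Pos)"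
    "sclass_of (\<beta>, (b', a'), Pos) = sclass_of (\<beta>, (a, b), Neg)" by simp_all
  moreover have "sclass_of (\<beta>, d, \<epsilon>) = sclass_of (\<alpha>, d, \<epsilon>)" if "d \<in> arr \<alpha>" for d \<epsilon>
    using smove_sclass_of[OF smove.regular2[OF that assms]] by simp
  ultimately show ?thesis
    unfolding mu_string_def arr using new by (simp cong: sum.cong)
qed

lemma type3_move_mu:
  assumes R: "type3_move \<alpha> R \<beta>" shows "mu_string \<beta> = mu_string \<alpha>"
proof -
  define F where "F \<gamma> e = sgen (sclass_of (\<gamma>, e, Pos)) - sgen (sclass_of (\<gamma>, e, Neg))" for \<gamma> e
  have "F \<alpha> d = F \<beta> d" if "d \<in> arr \<alpha> - fst ` R" for d
    unfolding F_def using that smove_sclass_of[OF smove.regular3[OF _ R]] by simp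
  moreover have "F \<alpha> (fst r) = F \<beta> (snd r)" if "r \<in> R" for r
    unfolding F_def using that smove_sclass_of[OF smove.singular3[OF R, of "fst r" "snd r"]] by simp
  ultimately have "sum (F \<alpha>) (arr \<alpha>) = sum (F \<beta>) (arr \<beta>)"
    unfolding type3_move_sum(1)[OF R] type3_move_sum(2)[OF R] by (intro arg_cong2[of _ _ _ _ "(+)"] sum.cong) auto
  then show ?thesis unfolding mu_string_def F_def by simp
qed

lemma move_mu: "move \<alpha> \<beta> \<Longrightarrow> mu_string \<alpha> = mu_string \<beta>"
  unfolding move_def using homeo_move_mu type1_move_mu type2_move_mu type3_move_mu by metis

lemma homotopic_mu: "homotopic_strings \<alpha> \<beta> \<Longrightarrow> mu_string \<alpha> = mu_string \<beta>"
  unfolding homotopic_strings_def by (rule equivclp_invariant[where f = mu_string, OF _ move_mu])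

text \<open>
  The values of \<open>\<mu>\<close> and \<open>\<nu>\<close> on a class are defined as the element of a set of values on its
  representatives, which an invariant function makes a singleton.
\<close>

lemma the_elem_class:
  assumes "\<And>\<alpha> \<beta>. homotopic_strings \<alpha> \<beta> \<Longrightarrow> f \<alpha> = f \<beta>"
  shows "the_elem (f ` {\<beta>. vclass_of \<beta> = vclass_of \<alpha>}) = f \<alpha>"
proof -
  have "f \<beta> = f \<alpha>" if "vclass_of \<beta> = vclass_of \<alpha>" for \<beta>
    using assms that vclass.abs_eq_iff by blast
  then have "f ` {\<beta>. vclass_of \<beta> = vclass_of \<alpha>} = {f \<alpha>}" by blast
  then show ?thesis by simp
qed

lemma mu_vclass_of: "mu (vclass_of \<alpha>) = mu_string \<alpha>"
  unfolding mu_def using homotopic_mu by (rule the_elem_class)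

section \<open>The cobracket as a linear image of \<open>\<mu>\<close>\<close>

definition tensor_of_sides :: "sclass \<Rightarrow> (vclass \<times> vclass) \<Rightarrow>\<^sub>0 int" where
  "tensor_of_sides X = (case sides (rep_sclass X) of (Y, Z) \<Rightarrow> tensor Y Z)"

lemma tensor_of_sides_sclass_of:
  "is_signed_singular s \<Longrightarrow> tensor_of_sides (sclass_of s) = (case sides s of (Y, Z) \<Rightarrow> tensor Y Z)"
  unfolding tensor_of_sides_def using rep_sclass_invariant[of sides s] smove_sides by simp

lemma trivial_class_restrict:
  assumes "arrows_in (arr \<alpha>) X = {}" shows "trivial_class (vclass_of (restrict_string \<alpha> X))"
proof -
  have "restrict_string \<alpha> X = empty_string"
    by (rule vstring_eqI) (use assms in \<open>simp add: arr_restrict empty_string.rep_eq\<close>)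
  then show ?thesis by (simp add: trivial_class_def)
qed

lemma semi_trivial_sides:
  assumes "semi_trivial_string (\<alpha>, d, \<epsilon>)"
  shows "trivial_class (vclass_of (side1 \<alpha> d)) \<or> trivial_class (vclass_of (side2 \<alpha> d))"
proof -
  obtain a b where d: "d = (a, b)" by fastforce
  have "arrows_in (arr \<alpha>) X = {}" if "X \<inter> endpoints \<alpha> = {}" for X
    using that arrow_ends(1) by blast
  then show ?thesis using assms trivial_class_restrict
    unfolding semi_trivial_string_def side1_def side2_def d by auto
qed

lemma tensor_of_sides_semi_trivial:
  assumes "semi_trivial_class X" shows "tensor_of_sides X = 0"
proof -
  obtain s where s: "semi_trivial_string s" "sclass_of s = X" using assms semi_trivial_class_def by blast
  obtain \<alpha> d \<epsilon> where "s = (\<alpha>, d, \<epsilon>)" by (cases s) auto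
  then show ?thesis
    using s tensor_of_sides_sclass_of[OF semi_trivial_is_signed_singular[OF s(1)]] semi_trivial_sides[of \<alpha> d \<epsilon>]
    by (cases \<epsilon>) (auto simp: sides_def tensor_def)
qed

lemma frag_extend_sgen: "frag_extend tensor_of_sides (sgen X) = tensor_of_sides X"
  using tensor_of_sides_semi_trivial by (simp add: sgen_def)

text \<open>
  Setting semi-trivial classes to 0 in \<open>\<mu>\<close> loses nothing here, since the tensor product of their
  sides is 0 as well.
\<close>

lemma nu_string_eq: "nu_string \<alpha> = frag_extend tensor_of_sides (mu_string \<alpha>)"
proof -
  have "is_signed_singular (\<alpha>, e, \<epsilon>)" if "e \<in> arr \<alpha>" for e \<epsilon>
    using that by (simp add: is_signed_singular_def)
  then show ?thesis
    unfolding mu_string_def nu_string_def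
    by (simp add: frag_extend_sum frag_extend_diff frag_extend_sgen o_def tensor_of_sides_sclass_of sides_def
        cong: sum.cong)
qed

lemma nu_vclass_of: "nu (vclass_of \<alpha>) = nu_string \<alpha>"
  unfolding nu_def by (rule the_elem_class) (simp add: nu_string_eq homotopic_mu)

section \<open>The number of terms\<close>

lemma num_terms_superset:
  assumes "finite S" "Poly_Mapping.keys L \<subseteq> S"
  shows "num_terms L = (\<Sum>x\<in>S. \<bar>Poly_Mapping.lookup L x\<bar>)"
  unfolding num_terms_def using assms by (intro sum.mono_neutral_left) (auto simp: in_keys_iff)

lemma num_terms_add: "num_terms (K + L) \<le> num_terms K + num_terms L"
proof -
  let ?S = "Poly_Mapping.keys K \<union> Poly_Mapping.keys L"
  have "num_terms (K + L) = (\<Sum>x\<in>?S. \<bar>Poly_Mapping.lookup (K + L) x\<bar>)"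
    by (rule num_terms_superset) (auto simp: keys_add)
  also have "\<dots> \<le> (\<Sum>x\<in>?S. \<bar>Poly_Mapping.lookup K x\<bar> + \<bar>Poly_Mapping.lookup L x\<bar>)"
    by (intro sum_mono) (simp add: lookup_add abs_triangle_ineq)
  also have "\<dots> = num_terms K + num_terms L"
    by (simp add: sum.distrib num_terms_superset[of ?S])
  finally show ?thesis .
qed

lemma num_terms_sum: "num_terms (\<Sum>i\<in>I. L i) \<le> (\<Sum>i\<in>I. num_terms (L i))"
proof (induction I rule: infinite_finite_induct)
  case (insert i I)
  then show ?case using num_terms_add[of "L i" "sum L I"] by simp
qed (simp_all add: num_terms_def)

lemma num_terms_cmul: "num_terms (frag_cmul c L) = \<bar>c\<bar> * num_terms L"
  by (subst num_terms_superset[of "Poly_Mapping.keys L"])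
    (auto simp: num_terms_def abs_mult sum_distrib_left)

lemma num_terms_frag_extend:
  assumes "\<And>x. num_terms (\<Phi> x) \<le> 1"
  shows "num_terms (frag_extend \<Phi> L) \<le> num_terms L"
proof -
  have "num_terms (frag_extend \<Phi> L) \<le>
      (\<Sum>x\<in>Poly_Mapping.keys L. num_terms (frag_cmul (Poly_Mapping.lookup L x) (\<Phi> x)))"
    unfolding frag_extend_def by (rule num_terms_sum)
  also have "\<dots> \<le> (\<Sum>x\<in>Poly_Mapping.keys L. \<bar>Poly_Mapping.lookup L x\<bar>)"
    unfolding num_terms_cmul by (intro sum_mono mult_left_le assms) simp
  finally show ?thesis by (simp add: num_terms_def)
qed

lemma num_terms_tensor: "num_terms (tensor Y Z) \<le> 1"
  by (simp add: tensor_def num_terms_def)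

lemma num_terms_nu_le_mu: "num_terms (nu (vclass_of \<alpha>)) \<le> num_terms (mu (vclass_of \<alpha>))"
  unfolding mu_vclass_of nu_vclass_of nu_string_eq
  by (rule num_terms_frag_extend) (simp add: tensor_of_sides_def num_terms_tensor split: prod.split)

lemma num_terms_pos:
  assumes "L \<noteq> 0" shows "num_terms L > 0"
proof -
  have "Poly_Mapping.keys L \<noteq> {}" using assms by simp
  then show ?thesis unfolding num_terms_def by (intro sum_pos) (auto simp: in_keys_iff)
qed

section \<open>A string on which \<open>\<nu>\<close> vanishes and \<open>\<mu>\<close> does not\<close>

definition class_index :: "sclass \<Rightarrow> int" where
  "class_index X = signed_index (rep_sclass X)"

lemma class_index_sclass_of:
  "is_signed_singular s \<Longrightarrow> class_index (sclass_of s) = signed_index s"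
  unfolding class_index_def by (rule rep_sclass_invariant[OF smove_signed_index])

text \<open>
  If one of the two arcs contains no ends at all, every other arrow has both its ends on the other one.
\<close>

lemma semi_trivial_crossing_index:
  assumes "semi_trivial_string (\<alpha>, d, \<epsilon>)"
  shows "crossing_index \<alpha> d = 0"
proof -
  obtain a b where d: "d = (a, b)" by fastforce
  have "d \<in> arr \<alpha>" and one: "open_arc a b \<inter> endpoints \<alpha> = {} \<or> open_arc b a \<inter> endpoints \<alpha> = {}"
    using assms d by (auto simp: semi_trivial_string_def)
  then have ab: "a \<noteq> b" "a \<in> core" "b \<in> core" "(a, b) \<in> arr \<alpha>" using arrow_ends[of d \<alpha>] d by auto
  define X where "X = open_arc a b"
  have "(fst g \<in> X \<longleftrightarrow> snd g \<in> X)" if g: "g \<in> arr \<alpha>" for g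
  proof (cases "g = d")
    case True
    then show ?thesis by (simp add: d X_def open_arc_def)
  next
    case False
    then have "{fst g, snd g} \<inter> {a, b} = {}"
      using is_virtual_string_arr[of \<alpha>] g ab(4) d unfolding is_virtual_string_def by fastforce
    then show ?thesis
      using one core_split[OF ab(2,3,1), of "fst g"] core_split[OF ab(2,3,1), of "snd g"] arrow_ends[OF g]
      unfolding X_def by blast
  qed
  then show ?thesis unfolding crossing_index_def flow_def d fst_conv snd_conv X_def[symmetric] by simp
qed

lemma semi_trivial_class_index:
  assumes "semi_trivial_class X" shows "class_index X = 0"
proof -
  obtain s where s: "semi_trivial_string s" "sclass_of s = X" using assms semi_trivial_class_def by blast
  obtain \<alpha> d \<epsilon> where "s = (\<alpha>, d, \<epsilon>)" by (cases s) auto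
  then show ?thesis
    using s class_index_sclass_of[OF semi_trivial_is_signed_singular[OF s(1)]] semi_trivial_crossing_index[of \<alpha> d \<epsilon>]
    by (cases \<epsilon>) (auto simp: signed_index_def)
qed

text \<open>
  A class of nonzero index is not semi-trivial, so its own generator is not set to 0.
\<close>

lemma lookup_sgen:
  assumes "class_index X \<noteq> 0"
  shows "Poly_Mapping.lookup (sgen Y) X = of_bool (X = Y)"
  using assms semi_trivial_class_index by (auto simp: sgen_def lookup_single when_def)

text \<open>
  Half-integral angles keep the points used below the full angle \<open>2 * pi\<close>, because \<open>pi \<ge> 2\<close>.
\<close>

definition example_point :: "nat \<Rightarrow> complex" where
  "example_point i = cis (real i / 2)"

lemma example_point_core: "example_point i \<in> core"
  by (simp add: example_point_def)

lemma Arg2pi_example_point: "i < 8 \<Longrightarrow> Arg2pi (example_point i) = real i / 2"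
  unfolding example_point_def using pi_ge_two by (intro Arg2pi_unique[of 1]) (auto simp: cis_conv_exp)

lemma example_point_eq_iff: "i < 8 \<Longrightarrow> j < 8 \<Longrightarrow> example_point i = example_point j \<longleftrightarrow> i = j"
  using core_eq_iff_Arg2pi[OF example_point_core example_point_core] by (simp add: Arg2pi_example_point)

lemma example_point_mem_open_arc:
  "i < 8 \<Longrightarrow> j < 8 \<Longrightarrow> k < 8 \<Longrightarrow>
    example_point i \<in> open_arc (example_point j) (example_point k) \<longleftrightarrow> (if j \<le> k then j < i \<and> i < k else j < i \<or> i < k)"
  by (subst mem_open_arc) (auto simp: example_point_core[unfolded mem_sphere_0] Arg2pi_example_point)

text \<open>
  The first arrow is crossed by the other two, which are nested and do not cross each other.
\<close>

definition example_arrows :: "arrow set" where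
  "example_arrows = {(example_point 0, example_point 3), (example_point 1, example_point 5), (example_point 2, example_point 4)}"

lemma is_virtual_string_example: "is_virtual_string example_arrows"
  unfolding example_arrows_def is_virtual_string_def
  by (simp add: example_point_eq_iff example_point_core[unfolded mem_sphere_0])

lemma exists_strict_inequality: "\<exists>X. num_terms (nu X) < num_terms (mu X)"
proof -
  obtain \<alpha> where \<alpha>: "arr \<alpha> = example_arrows"
    using is_virtual_string_example by (rule obtain_vstring)
  have "trivial_class (vclass_of (side1 \<alpha> e)) \<or> trivial_class (vclass_of (side2 \<alpha> e))" if "e \<in> arr \<alpha>" for e
  proof -
    have "arrows_in (arr \<alpha>) (open_arc (example_point 0) (example_point 3)) = {}" "arrows_in (arr \<alpha>) (open_arc (example_point 5) (example_point 1)) = {}"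
      "arrows_in (arr \<alpha>) (open_arc (example_point 2) (example_point 4)) = {}"
      unfolding \<alpha> example_arrows_def by (auto simp: example_point_mem_open_arc)
    note this[THEN trivial_class_restrict]
    then show ?thesis using that unfolding \<alpha> example_arrows_def side1_def side2_def by auto
  qed
  then have "tensor (vclass_of (side1 \<alpha> e)) (vclass_of (side2 \<alpha> e)) = 0 \<and>
      tensor (vclass_of (side2 \<alpha> e)) (vclass_of (side1 \<alpha> e)) = 0" if "e \<in> arr \<alpha>" for e
    using that unfolding tensor_def by meson
  then have "nu_string \<alpha> = 0" unfolding nu_string_def by simp
  then have nu: "num_terms (nu (vclass_of \<alpha>)) = 0" by (simp add: nu_vclass_of num_terms_def)
  have index: "crossing_index \<alpha> (example_point 0, example_point 3) = 2" "crossing_index \<alpha> (example_point 1, example_point 5) = - 1"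
    "crossing_index \<alpha> (example_point 2, example_point 4) = - 1"
    unfolding crossing_index_def \<alpha> example_arrows_def by (simp_all add: example_point_eq_iff example_point_mem_open_arc)
  have class_index: "class_index (sclass_of (\<alpha>, e, \<epsilon>)) = (case \<epsilon> of Pos \<Rightarrow> crossing_index \<alpha> e | Neg \<Rightarrow> - crossing_index \<alpha> e)"
    if "e \<in> example_arrows" for e \<epsilon>
    using that \<alpha> class_index_sclass_of by (simp add: is_signed_singular_def signed_index_def)
  define X where "X = sclass_of (\<alpha>, (example_point 0, example_point 3), Pos)"
  have idx: "class_index X = 2" "class_index (sclass_of (\<alpha>, (example_point 0, example_point 3), Neg)) = - 2"
    "class_index (sclass_of (\<alpha>, (example_point 1, example_point 5), Pos)) = - 1" "class_index (sclass_of (\<alpha>, (example_point 1, example_point 5), Neg)) = 1"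
    "class_index (sclass_of (\<alpha>, (example_point 2, example_point 4), Pos)) = - 1" "class_index (sclass_of (\<alpha>, (example_point 2, example_point 4), Neg)) = 1"
    unfolding X_def using class_index index by (simp_all add: example_arrows_def)
  then have ne: "X \<noteq> sclass_of (\<alpha>, (example_point 0, example_point 3), Neg)"
    "X \<noteq> sclass_of (\<alpha>, (example_point 1, example_point 5), Pos)" "X \<noteq> sclass_of (\<alpha>, (example_point 1, example_point 5), Neg)"
    "X \<noteq> sclass_of (\<alpha>, (example_point 2, example_point 4), Pos)" "X \<noteq> sclass_of (\<alpha>, (example_point 2, example_point 4), Neg)"
    by force+
  have "Poly_Mapping.lookup (mu_string \<alpha>) X = 1"
    unfolding mu_string_def \<alpha> example_arrows_def
    using ne idx(1) by (simp add: example_point_eq_iff lookup_add lookup_minus lookup_sgen X_def[symmetric])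
  then have "mu_string \<alpha> \<noteq> 0" by auto
  then have "num_terms (mu (vclass_of \<alpha>)) > 0" unfolding mu_vclass_of by (rule num_terms_pos)
  then show ?thesis using nu by (intro exI[of _ "vclass_of \<alpha>"]) simp
qed

theorem corollary1p2:
  shows "(\<forall>\<alpha>::vstring. num_terms (mu (vclass_of \<alpha>)) \<ge> num_terms (nu (vclass_of \<alpha>))) \<and>
         (\<exists>X::vclass. num_terms (mu X) > num_terms (nu X))"
  using num_terms_nu_le_mu exists_strict_inequality by blast

end
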